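(* Let $\Sigma$ be a finite alphabet and $(X,S)$ a Boolean space with an internal semigroup. Let $\mathcal{B}(X,\Sigma\times\{0,1\})_\exists$ denote the smallest Boolean subalgebra of $\mathcal{P}(\Sigma^+)$ closed under left and right quotients by words that contains $\{L_\exists\mid L\in\mathcal{B}(X,\Sigma\times\{0,1\})\}$. Then $\mathcal{B}(\Diamond X,\Sigma)$ coincides with the Boolean subalgebra of $\mathcal{P}(\Sigma^+)$ generated by $\mathcal{B}(X,\Sigma)\cup\mathcal{B}(X,\Sigma\times\{0,1\})_\exists$.
   Context: A Boolean space is a compact Hausdorff space with a clopen basis. A Boolean space with an internal semigroup is a pair $(X,S)$: $X$ a Boolean space, $S\subseteq X$ a dense subspace equipped with a semigroup structure, and compatible left and right actions of $S$ on $X$ with continuous components $\lambda_s,\rho_s\colon X\to X$ extending left and right multiplication by $s$ on $S$. A morphism $(X,S)\to(Y,T)$ is a continuous map $X\to Y$ restricting to a semigroup morphism $S\to T$. For a finite alphabet $A$, $\beta(A^+)$ is the Stone–Čech compactification of the discrete set $A^+$ (nonempty words): the ultrafilters of $\mathcal{P}(A^+)$, with basic clopens $\widehat{L}=\{\mu\mid L\in\mu\}$ and $A^+$ identified with principal ultrafilters; $(\beta(A^+),A^+)$ is a Boolean space with an internal semigroup via continuous extensions of concatenation. $\mathcal{B}(X,A)$ denotes the set of languages $L\subseteq A^+$ recognised by $(X,S)$, i.e. such that $\widehat{L}=f^{-1}(C)$ for some morphism $f\colon(\beta(A^+),A^+)\to(X,S)$ and clopen $C\subseteq X$. Let $\Sigma^+\otimes\mathbb{N}=\{(w,i)\mid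 w\in\Sigma^+, i<|w|\}$, $\pi$ the projection to $\Sigma^+$, and $\gamma_1\colon\Sigma^+\otimes\mathbb{N}\to(\Sigma\times\{0,1\})^+$, $(w,i)\mapsto w^{(i)}$, where $(w^{(i)})_j=(w_j,0)$ for $j\ne i$ and $(w^{(i)})_i=(w_i,1)$; for $L\subseteq(\Sigma\times\{0,1\})^+$ put $L_\exists=\pi[\gamma_1^{-1}(L)]$. The unary Schützenberger product (semigroup version) is $(\Diamond X,\Diamond S)$, where $\Diamond S$ is the semigroup on $\mathcal{P}^+_{\mathrm{fin}}(S)\times S$ (nonempty finite subsets) with $(P,m)*(Q,n)=(P\cdot n\cup m\cdot Q,mn)$, and $\Diamond X=\mathcal{V}^+(X)\times X$ with product topology, $\mathcal{V}^+(X)$ being the set of nonempty closed subsets of $X$ with the topology generated by $\Box V=\{K\mid K\subseteq V\}$ and $\Diamond V=\{K\mid K\cap V\ne\emptyset\}$ for $V$ clopen; the biaction is $l_{(P,m)}(K,x)=(\{\lambda_s(x)\mid s\in P\}\cup\lambda_m[K],\lambda_m(x))$ and $r_{(P,m)}(K,x)=(\{\rho_s(x)\mid s\in P\}\cup\rho_m[K],\rho_m(x))$.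
   Formalization: The left side is the Boolean subalgebra generated by B(◇X,Σ), not the set B(◇X,Σ) itself, which need not be a Boolean algebra (e.g. X=S=Z/2, |Σ|=3), so that the literal equality fails. *)

theory Defs
  imports "HOL-Analysis.Analysis"
begin

definition clopenin :: "'x topology \<Rightarrow> 'x set \<Rightarrow> bool" where
  "clopenin X C \<longleftrightarrow> openin X C \<and> closedin X C"

definition Boolean_space :: "'x topology \<Rightarrow> bool" where
  "Boolean_space X \<longleftrightarrow> compact_space X \<and> Hausdorff_space X \<and>
     openin X = arbitrary union_of (clopenin X)"


text \<open>
  The data of a pair $(X,S)$: the space $X$, the subset $S$, its multiplication, and the two
  actions, where \<open>lact \<X> s\<close> is $\lambda_s$ and \<open>ract \<X> s\<close> is $\rho_s$. The values of \<open>mult\<close>,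
  \<open>lact\<close> and \<open>ract\<close> are meaningful only when the semigroup arguments lie in \<open>sgp \<X>\<close> and the
  remaining argument lies in the space.
\<close>

record 'x internal_sgp =
  space_of :: "'x topology"
  sgp :: "'x set"
  mult :: "'x \<Rightarrow> 'x \<Rightarrow> 'x"
  lact :: "'x \<Rightarrow> 'x \<Rightarrow> 'x"
  ract :: "'x \<Rightarrow> 'x \<Rightarrow> 'x"

locale Boolean_space_internal_semigroup =
  fixes \<X> :: "'x internal_sgp"
  assumes Boolean: "Boolean_space (space_of \<X>)"
    and sgp_subset: "sgp \<X> \<subseteq> topspace (space_of \<X>)"
    and sgp_dense: "space_of \<X> closure_of sgp \<X> = topspace (space_of \<X>)"
    and mult_closed: "\<lbrakk>s \<in> sgp \<X>; t \<in> sgp \<X>\<rbrakk> \<Longrightarrow> mult \<X> s t \<in> sgp \<X>"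
    and mult_assoc: "\<lbrakk>s \<in> sgp \<X>; t \<in> sgp \<X>; u \<in> sgp \<X>\<rbrakk> \<Longrightarrow>
          mult \<X> (mult \<X> s t) u = mult \<X> s (mult \<X> t u)"
    and lact_continuous: "s \<in> sgp \<X> \<Longrightarrow> continuous_map (space_of \<X>) (space_of \<X>) (lact \<X> s)"
    and ract_continuous: "s \<in> sgp \<X> \<Longrightarrow> continuous_map (space_of \<X>) (space_of \<X>) (ract \<X> s)"
    and lact_extends: "\<lbrakk>s \<in> sgp \<X>; t \<in> sgp \<X>\<rbrakk> \<Longrightarrow> lact \<X> s t = mult \<X> s t"
    and ract_extends: "\<lbrakk>s \<in> sgp \<X>; t \<in> sgp \<X>\<rbrakk> \<Longrightarrow> ract \<X> s t = mult \<X> t s"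
    and lact_action: "\<lbrakk>s \<in> sgp \<X>; t \<in> sgp \<X>; x \<in> topspace (space_of \<X>)\<rbrakk> \<Longrightarrow>
          lact \<X> (mult \<X> s t) x = lact \<X> s (lact \<X> t x)"
    and ract_action: "\<lbrakk>s \<in> sgp \<X>; t \<in> sgp \<X>; x \<in> topspace (space_of \<X>)\<rbrakk> \<Longrightarrow>
          ract \<X> (mult \<X> s t) x = ract \<X> t (ract \<X> s x)"
    and actions_compatible: "\<lbrakk>s \<in> sgp \<X>; t \<in> sgp \<X>; x \<in> topspace (space_of \<X>)\<rbrakk> \<Longrightarrow>
          lact \<X> s (ract \<X> t x) = ract \<X> t (lact \<X> s x)"

definition internal_sgp_morphism ::
    "'x internal_sgp \<Rightarrow> 'y internal_sgp \<Rightarrow> ('x \<Rightarrow> 'y) \<Rightarrow> bool" where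
  "internal_sgp_morphism \<X> \<Y> f \<longleftrightarrow>
     continuous_map (space_of \<X>) (space_of \<Y>) f \<and>
     f ` sgp \<X> \<subseteq> sgp \<Y> \<and>
     (\<forall>s\<in>sgp \<X>. \<forall>t\<in>sgp \<X>. f (mult \<X> s t) = mult \<Y> (f s) (f t))"


definition ultrafilter_on :: "'w set \<Rightarrow> 'w set set \<Rightarrow> bool" where
  "ultrafilter_on W \<mu> \<longleftrightarrow> \<mu> \<subseteq> Pow W \<and> W \<in> \<mu> \<and> {} \<notin> \<mu> \<and>
     (\<forall>K\<in>\<mu>. \<forall>L\<in>\<mu>. K \<inter> L \<in> \<mu>) \<and>
     (\<forall>K\<in>\<mu>. \<forall>L. K \<subseteq> L \<and> L \<subseteq> W \<longrightarrow> L \<in> \<mu>) \<and>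
     (\<forall>L. L \<subseteq> W \<longrightarrow> L \<in> \<mu> \<or> W - L \<in> \<mu>)"

definition hat :: "'w set \<Rightarrow> 'w set \<Rightarrow> 'w set set set" where
  "hat W L = {\<mu>. ultrafilter_on W \<mu> \<and> L \<in> \<mu>}"

definition stone_cech :: "'w set \<Rightarrow> 'w set set topology" where
  "stone_cech W = topology_generated_by {hat W L |L. L \<subseteq> W}"

definition principal_uf :: "'w set \<Rightarrow> 'w \<Rightarrow> 'w set set" where
  "principal_uf W w = {L. L \<subseteq> W \<and> w \<in> L}"

definition generator :: "'w set \<Rightarrow> 'w set set \<Rightarrow> 'w" where
  "generator W \<mu> = (THE w. w \<in> W \<and> \<mu> = principal_uf W w)"

text \<open>The continuous extension $\beta W \to \beta W$ of a map $h\colon W \to W$.\<close>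

definition stone_cech_map :: "'w set \<Rightarrow> ('w \<Rightarrow> 'w) \<Rightarrow> 'w set set \<Rightarrow> 'w set set" where
  "stone_cech_map W h \<mu> = {L. L \<subseteq> W \<and> {w \<in> W. h w \<in> L} \<in> \<mu>}"


definition words :: "'a set \<Rightarrow> 'a list set" where
  "words A = lists A - {[]}"

definition beta_words :: "'a set \<Rightarrow> 'a list set set internal_sgp" where
  "beta_words A = (let W = words A in
     \<lparr> space_of = stone_cech W,
       sgp = principal_uf W ` W,
       mult = (\<lambda>p q. principal_uf W (generator W p @ generator W q)),
       lact = (\<lambda>p. stone_cech_map W (\<lambda>w. generator W p @ w)),
       ract = (\<lambda>p. stone_cech_map W (\<lambda>w. w @ generator W p)) \<rparr>)"

text \<open>
  The set $\mathcal{B}(X,A)$ of recognised languages. The morphism is allowed to depend on the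
  language, so this set need not be closed under binary unions and intersections: for $X = S$ the
  two-element group and $A = \{a,b\}$, it contains the words with an even number of $a$ and those
  with an even number of $b$, but not their intersection. Hence a comparison of
  $\mathcal{B}(X,A)$ with a Boolean algebra has to be made through the subalgebra it generates.
\<close>

definition recognised :: "'x internal_sgp \<Rightarrow> 'a set \<Rightarrow> 'a list set set" where
  "recognised \<X> A = {L. L \<subseteq> words A \<and>
     (\<exists>f C. internal_sgp_morphism (beta_words A) \<X> f \<and> clopenin (space_of \<X>) C \<and>
        hat (words A) L = {\<mu> \<in> topspace (space_of (beta_words A)). f \<mu> \<in> C})}"


definition marked_words :: "'a set \<Rightarrow> ('a list \<times> nat) set" where
  "marked_words A = {(w, i). w \<in> words A \<and> i < length w}"

definition gamma1 :: "'a list \<times> nat \<Rightarrow> ('a \<times> nat) list" where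
  "gamma1 = (\<lambda>(w, i). map (\<lambda>j. (w ! j, if j = i then 1 else 0)) [0..<length w])"

definition exists_lang :: "'a set \<Rightarrow> ('a \<times> nat) list set \<Rightarrow> 'a list set" where
  "exists_lang A L = fst ` {p \<in> marked_words A. gamma1 p \<in> L}"

definition quotient_closed :: "'a set \<Rightarrow> 'a list set set \<Rightarrow> bool" where
  "quotient_closed A \<B> \<longleftrightarrow> (\<forall>L\<in>\<B>. \<forall>u\<in>words A.
     {v \<in> words A. u @ v \<in> L} \<in> \<B> \<and> {v \<in> words A. v @ u \<in> L} \<in> \<B>)"

text \<open>
  Boolean subalgebras of $\mathcal{P}(A^+)$ are the families \<open>\<B>\<close> with \<open>algebra (words A) \<B>\<close>.
\<close>

definition recognised_exists :: "'x internal_sgp \<Rightarrow> 'a set \<Rightarrow> 'a list set set" where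
  "recognised_exists \<X> A =
     (\<lambda>\<B>. algebra (words A) \<B> \<and> quotient_closed A \<B>) hull
       {exists_lang A L |L. L \<in> recognised \<X> (A \<times> {0, 1})}"


definition vietoris_points :: "'x topology \<Rightarrow> 'x set set" where
  "vietoris_points X = {K. closedin X K \<and> K \<noteq> {}}"

definition vietoris :: "'x topology \<Rightarrow> 'x set topology" where
  "vietoris X = topology_generated_by
     ({{K \<in> vietoris_points X. K \<subseteq> V} |V. clopenin X V} \<union>
      {{K \<in> vietoris_points X. K \<inter> V \<noteq> {}} |V. clopenin X V})"

text \<open>
  The unary Schuetzenberger product. Finite nonempty subsets of $S$ are closed in the
  Hausdorff space $X$, so the semigroup is a subset of the space.
\<close>

definition schutzenberger :: "'x internal_sgp \<Rightarrow> ('x set \<times> 'x) internal_sgp" where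
  "schutzenberger \<X> =
     \<lparr> space_of = prod_topology (vietoris (space_of \<X>)) (space_of \<X>),
       sgp = {P. finite P \<and> P \<noteq> {} \<and> P \<subseteq> sgp \<X>} \<times> sgp \<X>,
       mult = (\<lambda>(P, m) (Q, n).
         ((\<lambda>p. mult \<X> p n) ` P \<union> (\<lambda>q. mult \<X> m q) ` Q, mult \<X> m n)),
       lact = (\<lambda>(P, m) (K, x). ((\<lambda>s. lact \<X> s x) ` P \<union> lact \<X> m ` K, lact \<X> m x)),
       ract = (\<lambda>(P, m) (K, x). ((\<lambda>s. ract \<X> s x) ` P \<union> ract \<X> m ` K, ract \<X> m x)) \<rparr>"

end

theory Submission
  imports Defs
begin

text \<open>
  A morphism from the Stone-Cech compactification of the words is the same as a homomorphism on
  words, since limits along ultrafilters exist in a Boolean space and in its Vietoris space. A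
  homomorphism into \<open>\<Diamond>S\<close> is a pair \<open>(F, g)\<close> with \<open>g\<close> a homomorphism into \<open>S\<close> and
  \<open>F (u v) = F u \<cdot> g v \<union> g u \<cdot> F v\<close>. As \<open>\<beta>(\<Sigma>\<^sup>+)\<close> is compact and the topology of \<open>\<Diamond>X\<close> is generated
  by the sets \<open>\<Diamond>V \<times> X\<close>, \<open>\<V>\<^sup>+(X) \<times> V\<close> and their complements, the languages recognised by \<open>\<Diamond>X\<close>
  generate the same algebra as those recognised by \<open>X\<close> together with the languages
  \<open>{w. F w \<inter> V \<noteq> {}}\<close>. A quotient of such a language is again one, up to a union with a language
  recognised by \<open>X\<close>. Taking \<open>F w\<close> to be the set of all \<open>g (w\<^sup>(\<^sup>i\<^sup>))\<close> shows that every
  \<open>L\<^sub>\<exists>\<close> has this form. Conversely, \<open>{w. F w \<inter> V \<noteq> {}}\<close> is the union of the \<open>L\<^sub>\<exists>\<close> over the finitely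
  many ways of choosing an element of \<open>F a\<close> as the value of the marked letter \<open>a\<close>.
\<close>

section \<open>Ultrafilters\<close>

text \<open>Zorn's lemma on intersection-closed families without the empty set; upward closure of a
  maximal one is a consequence of its maximality.\<close>

lemma ultrafilter_on_extends:
  assumes "\<G> \<subseteq> Pow W" "\<G> \<noteq> {}" "{} \<notin> \<G>" "\<And>K L. K \<in> \<G> \<Longrightarrow> L \<in> \<G> \<Longrightarrow> K \<inter> L \<in> \<G>"
  obtains \<mu> where "ultrafilter_on W \<mu>" "\<G> \<subseteq> \<mu>"
proof -
  define P where "P = {\<F>. \<G> \<subseteq> \<F> \<and> \<F> \<subseteq> Pow W \<and> {} \<notin> \<F> \<and> (\<forall>K\<in>\<F>. \<forall>L\<in>\<F>. K \<inter> L \<in> \<F>)}"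
  have "\<exists>M\<in>P. \<forall>X\<in>P. M \<subseteq> X \<longrightarrow> X = M"
  proof (rule subset_Zorn_nonempty)
    have "\<G> \<in> P"
      unfolding P_def using assms by simp
    then show "P \<noteq> {}"
      by (metis empty_iff)
    fix C assume C: "C \<noteq> {}" "subset.chain P C"
    have CP: "\<F> \<in> P" if "\<F> \<in> C" for \<F>
      using C(2) that by (auto simp: subset.chain_def)
    have "K \<inter> L \<in> \<Union>C" if KL: "K \<in> \<Union>C" "L \<in> \<Union>C" for K L
    proof -
      obtain F G where FG: "F \<in> C" "K \<in> F" "G \<in> C" "L \<in> G"
        using KL by blast
      then have "F \<subseteq> G \<or> G \<subseteq> F"
        using C(2) by (auto simp: subset.chain_def)
      then obtain H where "H \<in> C" "K \<in> H" "L \<in> H"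
        using FG by blast
      then show ?thesis
        using CP[of H] unfolding P_def by blast
    qed
    moreover have C_sub: "\<G> \<subseteq> \<F>" "\<F> \<subseteq> Pow W" "{} \<notin> \<F>" if "\<F> \<in> C" for \<F>
      using CP[OF that] unfolding P_def by simp_all
    moreover have "\<G> \<subseteq> \<Union>C"
      using C(1) C_sub(1) by (meson Union_upper equals0I subset_trans)
    moreover have "\<Union>C \<subseteq> Pow W"
      using C_sub(2) by (rule Union_least)
    moreover have "{} \<notin> \<Union>C"
      using C_sub(3) by simp
    ultimately show "\<Union>C \<in> P"
      unfolding P_def by simp
  qed
  then obtain \<mu> where \<mu>: "\<mu> \<in> P" and maximal: "\<And>\<F>. \<F> \<in> P \<Longrightarrow> \<mu> \<subseteq> \<F> \<Longrightarrow> \<F> = \<mu>"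
    by metis
  have sub: "\<G> \<subseteq> \<mu>" "\<mu> \<subseteq> Pow W" "{} \<notin> \<mu>" and inter: "\<And>K L. K \<in> \<mu> \<Longrightarrow> L \<in> \<mu> \<Longrightarrow> K \<inter> L \<in> \<mu>"
    using \<mu> unfolding P_def by simp_all
  have ne: "\<mu> \<noteq> {}"
    using sub(1) assms(2) by auto
  \<comment> \<open>A set that meets every member of \<mu> can be adjoined: the filter
    \<open>\<F>\<close> generated by \<mu> and \<open>L\<close> is again in \<open>P\<close>. Upward
    closure and the dichotomy between \<open>L\<close> and \<open>W - L\<close> both come from
    this.\<close>
  have add: "L \<in> \<mu>" if L: "L \<subseteq> W" "\<And>M. M \<in> \<mu> \<Longrightarrow> L \<inter> M \<noteq> {}" for L
  proof -
    define \<F> where "\<F> = {K. K \<subseteq> W \<and> (\<exists>M\<in>\<mu>. L \<inter> M \<subseteq> K)}"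
    have "K \<inter> K' \<in> \<F>" if "K \<in> \<F>" "K' \<in> \<F>" for K K'
    proof -
      obtain M M' where "M \<in> \<mu>" "L \<inter> M \<subseteq> K" "M' \<in> \<mu>" "L \<inter> M' \<subseteq> K'" "K \<subseteq> W"
        using \<open>K \<in> \<F>\<close> \<open>K' \<in> \<F>\<close> unfolding \<F>_def by blast
      then have "M \<inter> M' \<in> \<mu>" "L \<inter> (M \<inter> M') \<subseteq> K \<inter> K'" "K \<inter> K' \<subseteq> W"
        using inter by auto
      then show ?thesis
        unfolding \<F>_def by blast
    qed
    moreover have "{} \<notin> \<F>"
      using L(2) by (auto simp: \<F>_def)
    moreover have above: "\<mu> \<subseteq> \<F>"
      using sub(2) by (auto simp: \<F>_def)
    moreover have "\<F> \<subseteq> Pow W"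
      by (auto simp: \<F>_def)
    ultimately have "\<F> \<in> P"
      using sub(1) unfolding P_def by simp
    then have "\<F> = \<mu>"
      using above by (rule maximal)
    moreover have "L \<in> \<F>"
      using L(1) ne by (auto simp: \<F>_def)
    ultimately show ?thesis
      by simp
  qed
  have up: "L \<in> \<mu>" if "K \<in> \<mu>" "K \<subseteq> L" "L \<subseteq> W" for K L
  proof (rule add)
    fix M assume "M \<in> \<mu>"
    then have "K \<inter> M \<noteq> {}"
      using inter[OF that(1)] sub(3) by metis
    then show "L \<inter> M \<noteq> {}"
      using that by blast
  qed fact
  moreover have "L \<in> \<mu> \<or> W - L \<in> \<mu>" if "L \<subseteq> W" for L
  proof (rule ccontr)
    assume "\<not> ?thesis"
    then have "L \<notin> \<mu>" "W - L \<notin> \<mu>"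
      by simp_all
    obtain M where M: "M \<in> \<mu>" "L \<inter> M = {}"
      using add[of L] \<open>L \<subseteq> W\<close> \<open>L \<notin> \<mu>\<close> by metis
    obtain M' where M': "M' \<in> \<mu>" "(W - L) \<inter> M' = {}"
      using add[of "W - L"] \<open>W - L \<notin> \<mu>\<close> by (metis Diff_subset)
    have "M \<subseteq> W"
      using M(1) sub(2) by auto
    then have "M \<inter> M' = {}"
      using M(2) M'(2) by auto
    then show False
      using inter[OF M(1) M'(1)] sub(3) by simp
  qed
  moreover have "W \<in> \<mu>"
    using ne up[of _ W] sub(2) by auto
  ultimately have "ultrafilter_on W \<mu>"
    using sub inter unfolding ultrafilter_on_def by simp
  then show ?thesis
    using sub(1) that by blast
qed

lemma ultrafilter_on_principal_uf: "w \<in> W \<Longrightarrow> ultrafilter_on W (principal_uf W w)"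
  by (auto simp: ultrafilter_on_def principal_uf_def)

lemma ultrafilter_on_mono:
  "ultrafilter_on W \<mu> \<Longrightarrow> K \<in> \<mu> \<Longrightarrow> K \<subseteq> L \<Longrightarrow> L \<subseteq> W \<Longrightarrow> L \<in> \<mu>"
  by (auto simp: ultrafilter_on_def)

lemma ultrafilter_on_Int: "ultrafilter_on W \<mu> \<Longrightarrow> K \<in> \<mu> \<Longrightarrow> L \<in> \<mu> \<Longrightarrow> K \<inter> L \<in> \<mu>"
  by (auto simp: ultrafilter_on_def)

lemma ultrafilter_on_Diff_iff:
  assumes "ultrafilter_on W \<mu>" "L \<subseteq> W"
  shows "W - L \<in> \<mu> \<longleftrightarrow> L \<notin> \<mu>"
proof -
  have "L \<inter> (W - L) \<notin> \<mu>"
    using assms(1) by (auto simp: ultrafilter_on_def)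
  then show ?thesis
    using assms unfolding ultrafilter_on_def by blast
qed

lemma ultrafilter_on_Un_iff:
  assumes "ultrafilter_on W \<mu>" "K \<subseteq> W" "L \<subseteq> W"
  shows "K \<union> L \<in> \<mu> \<longleftrightarrow> K \<in> \<mu> \<or> L \<in> \<mu>"
proof -
  have "L \<in> \<mu>" if "K \<union> L \<in> \<mu>" "K \<notin> \<mu>"
  proof -
    have "(K \<union> L) \<inter> (W - K) \<in> \<mu>"
      using that assms by (intro ultrafilter_on_Int[OF assms(1)]) (simp_all add: ultrafilter_on_Diff_iff)
    then show ?thesis
      by (rule ultrafilter_on_mono[OF assms(1)]) (use assms in auto)
  qed
  then show ?thesis
    using assms ultrafilter_on_mono[OF assms(1)] by (metis Un_least Un_upper1 Un_upper2)
qed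

lemma ultrafilter_on_UN_iff:
  assumes "ultrafilter_on W \<mu>" "finite I" "\<And>i. i \<in> I \<Longrightarrow> K i \<subseteq> W"
  shows "(\<Union>i\<in>I. K i) \<in> \<mu> \<longleftrightarrow> (\<exists>i\<in>I. K i \<in> \<mu>)"
  using assms(2,3)
proof (induction I)
  case empty
  then show ?case using assms(1) by (simp add: ultrafilter_on_def)
next
  case (insert i I)
  then have "(\<Union>i\<in>I. K i) \<subseteq> W" by auto
  then show ?case
    using insert ultrafilter_on_Un_iff[OF assms(1)] by simp
qed

lemma principal_uf_in_hat_iff: "w \<in> W \<Longrightarrow> L \<subseteq> W \<Longrightarrow> principal_uf W w \<in> hat W L \<longleftrightarrow> w \<in> L"
  by (auto simp: hat_def ultrafilter_on_principal_uf) (auto simp: principal_uf_def)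

lemma generator_principal_uf [simp]:
  assumes "w \<in> W"
  shows "generator W (principal_uf W w) = w"
  unfolding generator_def
proof (rule the_equality)
  fix v assume v: "v \<in> W \<and> principal_uf W w = principal_uf W v"
  have "{w} \<in> principal_uf W w"
    using assms by (simp add: principal_uf_def)
  then have "{w} \<in> principal_uf W v"
    using v by simp
  then show "v = w"
    by (simp add: principal_uf_def)
qed (use assms in simp)

section \<open>The topology of the Stone-Cech compactification\<close>

text \<open>For a subalgebra \<open>B\<close> this is a coarser topology on the same set of
  ultrafilters; those that agree on \<open>B\<close> are not separated. It stands in for the Stone
  space of \<open>B\<close> and avoids forming a quotient space.\<close>

definition hat_topology :: "'w set \<Rightarrow> 'w set set \<Rightarrow> 'w set set topology" where
  "hat_topology W B = topology_generated_by {hat W M |M. M \<in> B}"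

lemma topspace_hat_topology:
  assumes "algebra W B"
  shows "topspace (hat_topology W B) = {\<mu>. ultrafilter_on W \<mu>}"
proof -
  interpret algebra W B by fact
  have "{\<mu>. ultrafilter_on W \<mu>} \<subseteq> hat W W"
    by (auto simp: hat_def ultrafilter_on_def)
  then show ?thesis
    unfolding hat_topology_def topology_generated_by_topspace using top by (auto simp: hat_def)
qed

lemma clopenin_hat_topology:
  assumes "algebra W B" "L \<in> B"
  shows "clopenin (hat_topology W B) (hat W L)"
proof -
  interpret algebra W B by fact
  let ?T = "hat_topology W B"
  have opn: "openin ?T (hat W M)" if "M \<in> B" for M
    unfolding hat_topology_def using that by (intro topology_generated_by_Basis) auto
  have "L \<subseteq> W"
    using assms(2) sets_into_space by blast
  then have "topspace ?T - hat W L = hat W (W - L)"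
    using ultrafilter_on_Diff_iff[of W _ L] by (auto simp: topspace_hat_topology[OF assms(1)] hat_def)
  then show ?thesis
    using opn[OF assms(2)] opn[of "W - L"] assms(2) openin_subset[of ?T "hat W L"]
    by (auto simp: clopenin_def closedin_def)
qed

lemma algebra_Pow: "algebra W (Pow W)"
  by (auto simp: algebra_iff_Un)

lemma stone_cech_eq_hat_topology: "stone_cech W = hat_topology W (Pow W)"
  by (simp add: stone_cech_def hat_topology_def)

lemma topspace_stone_cech: "topspace (stone_cech W) = {\<mu>. ultrafilter_on W \<mu>}"
  unfolding stone_cech_eq_hat_topology by (rule topspace_hat_topology[OF algebra_Pow])

lemma clopenin_hat: "L \<subseteq> W \<Longrightarrow> clopenin (stone_cech W) (hat W L)"
  unfolding stone_cech_eq_hat_topology by (rule clopenin_hat_topology[OF algebra_Pow]) simp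

lemma openin_hat: "L \<subseteq> W \<Longrightarrow> openin (stone_cech W) (hat W L)"
  using clopenin_hat by (auto simp: clopenin_def)

text \<open>As \<open>B\<close> is closed under intersections, the sets \<open>hat W M\<close> with
  \<open>M\<close> in \<open>B\<close> form a base.\<close>

lemma openin_hat_topology_local:
  assumes "algebra W B" "openin (hat_topology W B) U" "\<mu> \<in> U"
  shows "\<exists>M\<in>B. M \<in> \<mu> \<and> hat W M \<subseteq> U"
proof -
  interpret algebra W B by fact
  have "generate_topology_on {hat W M |M. M \<in> B} U"
    using assms(2) by (simp add: hat_topology_def openin_topology_generated_by_iff)
  \<comment> \<open>That every point is an ultrafilter is carried through the induction because the
    intersection case needs it to pass from \<open>M\<close> and \<open>N\<close> to
    \<open>M \<inter> N\<close>.\<close>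
  then have "\<forall>\<mu>\<in>U. ultrafilter_on W \<mu> \<and> (\<exists>M\<in>B. M \<in> \<mu> \<and> hat W M \<subseteq> U)"
  proof induction
    case Empty
    then show ?case by simp
  next
    case (Int a b)
    show ?case
    proof
      fix \<mu> assume \<mu>: "\<mu> \<in> a \<inter> b"
      then have u: "ultrafilter_on W \<mu>"
        using Int.IH(1) by simp
      obtain M where "M \<in> B" "M \<in> \<mu>" "hat W M \<subseteq> a"
        using Int.IH(1) \<mu> by auto
      moreover obtain N where "N \<in> B" "N \<in> \<mu>" "hat W N \<subseteq> b"
        using Int.IH(2) \<mu> by auto
      ultimately have MN: "M \<in> B" "M \<in> \<mu>" "hat W M \<subseteq> a" "N \<in> B" "N \<in> \<mu>" "hat W N \<subseteq> b"
        by simp_all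
      have "M \<subseteq> W" "N \<subseteq> W"
        using MN(1,4) sets_into_space by blast+
      then have "hat W (M \<inter> N) \<subseteq> hat W M \<inter> hat W N"
        using ultrafilter_on_mono[of W _ "M \<inter> N" M] ultrafilter_on_mono[of W _ "M \<inter> N" N]
        by (auto simp: hat_def)
      then have "hat W (M \<inter> N) \<subseteq> a \<inter> b"
        using MN by blast
      then show "ultrafilter_on W \<mu> \<and> (\<exists>M\<in>B. M \<in> \<mu> \<and> hat W M \<subseteq> a \<inter> b)"
        using u ultrafilter_on_Int[OF u MN(2,5)] MN(1,4) by (intro conjI bexI[of _ "M \<inter> N"]) auto
    qed
  next
    case (UN K)
    show ?case
    proof
      fix \<mu> assume "\<mu> \<in> \<Union>K"
      then obtain k where "k \<in> K" "\<mu> \<in> k"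
        by blast
      then show "ultrafilter_on W \<mu> \<and> (\<exists>M\<in>B. M \<in> \<mu> \<and> hat W M \<subseteq> \<Union>K)"
        using UN.IH[of k] by (meson Union_upper order_trans)
    qed
  next
    case (Basis s)
    then show ?case by (auto simp: hat_def)
  qed
  then show ?thesis
    using assms(3) by blast
qed

text \<open>If \<open>hat W M\<close> is a neighbourhood of \<mu> inside the preimage of an open
  \<open>D\<close>, the principal ultrafilters at points of \<open>M\<close> also map into
  \<open>D\<close>, so the trace of the preimage on \<open>W\<close> contains \<open>M\<close> and
  belongs to \<mu>. Applied to \<open>C\<close> and to its complement, this gives both
  inclusions.\<close>

lemma clopen_preimage_eq_hat:
  assumes f: "continuous_map (stone_cech W) Y f" and C: "clopenin Y C"
  shows "{\<mu> \<in> topspace (stone_cech W). f \<mu> \<in> C} = hat W {w \<in> W. f (principal_uf W w) \<in> C}"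
proof -
  have *: "{w \<in> W. f (principal_uf W w) \<in> D} \<in> \<mu>"
    if "openin Y D" "ultrafilter_on W \<mu>" "f \<mu> \<in> D" for D \<mu>
  proof -
    have "openin (stone_cech W) {\<mu> \<in> topspace (stone_cech W). f \<mu> \<in> D}"
      using f that(1) by (rule openin_continuous_map_preimage)
    then have "openin (hat_topology W (Pow W))
        {\<mu> \<in> topspace (stone_cech W). f \<mu> \<in> D}"
      by (simp add: stone_cech_eq_hat_topology)
    moreover have "\<mu> \<in> {\<mu> \<in> topspace (stone_cech W). f \<mu> \<in> D}"
      using that by (simp add: topspace_stone_cech)
    ultimately obtain M where M: "M \<subseteq> W" "M \<in> \<mu>" "hat W M \<subseteq> {\<mu> \<in> topspace (stone_cech W). f \<mu> \<in> D}"
      using openin_hat_topology_local[OF algebra_Pow] by blast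
    have "M \<subseteq> {w \<in> W. f (principal_uf W w) \<in> D}"
      using M(1,3) principal_uf_in_hat_iff[of _ W M] by blast
    then show ?thesis
      by (intro ultrafilter_on_mono[OF that(2) M(2)]) auto
  qed
  have opn: "openin Y C" "openin Y (topspace Y - C)"
    using C by (auto simp: clopenin_def)
  have "f \<mu> \<in> C" if u: "ultrafilter_on W \<mu>" "{w \<in> W. f (principal_uf W w) \<in> C} \<in> \<mu>" for \<mu>
  proof (rule ccontr)
    assume "f \<mu> \<notin> C"
    then have "f \<mu> \<in> topspace Y - C"
      using f u(1) by (auto simp: continuous_map_def topspace_stone_cech)
    then have "{w \<in> W. f (principal_uf W w) \<in> topspace Y - C} \<in> \<mu>"
      using * opn(2) u(1) by blast
    then have "{w \<in> W. f (principal_uf W w) \<in> C} \<inter> {w \<in> W. f (principal_uf W w) \<in> topspace Y - C} \<in> \<mu>"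
      using ultrafilter_on_Int u by blast
    moreover have "{w \<in> W. f (principal_uf W w) \<in> C} \<inter> {w \<in> W. f (principal_uf W w) \<in> topspace Y - C} = {}"
      by auto
    ultimately show False
      using u(1) by (simp add: ultrafilter_on_def)
  qed
  then show ?thesis
    using * opn(1) by (auto simp: hat_def topspace_stone_cech)
qed

text \<open>This is where the compactness of the space of ultrafilters enters: an open set of the coarser
  topology that is of the form \<open>hat W L\<close> is a finite union of sets \<open>hat W M\<close>.\<close>

lemma hat_open_imp_mem:
  assumes B: "algebra W B" and L: "L \<subseteq> W"
    and opn: "openin (hat_topology W B) (hat W L)"
  shows "L \<in> B"
proof (rule ccontr)
  assume nL: "L \<notin> B"
  interpret algebra W B by fact
  \<comment> \<open>If \<open>L\<close> is not in \<open>B\<close>, these sets are nonempty and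
    closed under intersections. An ultrafilter containing all of them lies in
    \<open>hat W L\<close>, but in no \<open>hat W M\<close> with \<open>M\<close> in
    \<open>B\<close> below \<open>L\<close>.\<close>
  define \<G> where "\<G> = {L - M |M. M \<in> B \<and> M \<subseteq> L}"
  obtain \<mu> where \<mu>: "ultrafilter_on W \<mu>" "\<G> \<subseteq> \<mu>"
  proof (rule ultrafilter_on_extends)
    show "\<G> \<subseteq> Pow W" using L by (auto simp: \<G>_def)
    show "\<G> \<noteq> {}" by (auto simp: \<G>_def)
    show "{} \<notin> \<G>"
    proof
      assume "{} \<in> \<G>"
      then obtain M where "M \<in> B" "M \<subseteq> L" "L - M = {}"
        by (auto simp: \<G>_def)
      then have "L = M" by blast
      then show False using nL \<open>M \<in> B\<close> by simp
    qed
    fix K K' assume "K \<in> \<G>" "K' \<in> \<G>"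
    then obtain M M' where M: "M \<in> B" "M \<subseteq> L" "K = L - M" "M' \<in> B" "M' \<subseteq> L" "K' = L - M'"
      by (auto simp: \<G>_def)
    then have "K \<inter> K' = L - (M \<union> M')" "M \<union> M' \<in> B" "M \<union> M' \<subseteq> L"
      by auto
    then show "K \<inter> K' \<in> \<G>"
      unfolding \<G>_def by blast
  qed
  have "L - {} \<in> \<G>"
    unfolding \<G>_def by blast
  then have "\<mu> \<in> hat W L"
    using \<mu> by (auto simp: hat_def)
  then obtain M where M: "M \<in> B" "M \<in> \<mu>" "hat W M \<subseteq> hat W L"
    using openin_hat_topology_local[OF B opn] by blast
  have "M \<subseteq> W"
    using M(1) sets_into_space by blast
  then have "M \<subseteq> L"
    using M(3) L principal_uf_in_hat_iff[of _ W] by blast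
  then have "L - M \<in> \<mu>"
    using \<mu>(2) M(1) unfolding \<G>_def by blast
  then have "M \<inter> (L - M) \<in> \<mu>"
    using M(2) ultrafilter_on_Int[OF \<mu>(1)] by blast
  then show False
    using \<mu>(1) by (simp add: ultrafilter_on_def)
qed

section \<open>Extension of maps to the Stone-Cech compactification\<close>

lemma clopenin_Diff: "clopenin X V \<Longrightarrow> clopenin X (topspace X - V)"
  by (auto simp: clopenin_def)

lemma clopenin_topspace: "clopenin X (topspace X)"
  by (auto simp: clopenin_def)

lemma clopenin_subset: "clopenin X V \<Longrightarrow> V \<subseteq> topspace X"
  by (auto simp: clopenin_def openin_subset)

lemma clopenin_preimage:
  "continuous_map X Y f \<Longrightarrow> clopenin Y C \<Longrightarrow> clopenin X {x \<in> topspace X. f x \<in> C}"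
  by (simp add: clopenin_def openin_continuous_map_preimage closedin_continuous_map_preimage)

lemma clopenin_UN: "finite I \<Longrightarrow> (\<And>i. i \<in> I \<Longrightarrow> clopenin X (V i)) \<Longrightarrow> clopenin X (\<Union>i\<in>I. V i)"
  by (auto simp: clopenin_def intro!: closedin_Union)

lemma Boolean_space_clopen_nbhd:
  assumes "Boolean_space X" "openin X U" "x \<in> U"
  obtains V where "clopenin X V" "x \<in> V" "V \<subseteq> U"
proof -
  have "(arbitrary union_of (clopenin X)) U"
    using assms(1,2) by (simp add: Boolean_space_def)
  then obtain \<U> where "\<U> \<subseteq> Collect (clopenin X)" "\<Union>\<U> = U"
    by (auto simp: union_of_def)
  then show ?thesis
    using assms(3) that by blast
qed

text \<open>The source \<open>T\<close> is arbitrary because the lemma serves both the Stone-Cech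
  topology and the coarser \<open>hat_topology\<close>.\<close>

lemma continuous_map_Boolean_space:
  assumes X: "Boolean_space X" and f: "\<And>x. x \<in> topspace T \<Longrightarrow> f x \<in> topspace X"
    and pre: "\<And>V. clopenin X V \<Longrightarrow> openin T {x \<in> topspace T. f x \<in> V}"
  shows "continuous_map T X f"
  unfolding continuous_map_def
proof (intro conjI allI impI)
  fix U assume U: "openin X U"
  show "openin T {x \<in> topspace T. f x \<in> U}"
  proof (subst openin_subopen, intro ballI)
    fix x assume x: "x \<in> {x \<in> topspace T. f x \<in> U}"
    then obtain V where V: "clopenin X V" "f x \<in> V" "V \<subseteq> U"
      using Boolean_space_clopen_nbhd[OF X U, of "f x"] by auto
    then have "x \<in> {x \<in> topspace T. f x \<in> V}" "{x \<in> topspace T. f x \<in> V} \<subseteq> {x \<in> topspace T. f x \<in> U}"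
      using x by auto
    then show "\<exists>S. openin T S \<and> x \<in> S \<and> S \<subseteq> {x \<in> topspace T. f x \<in> U}"
      using pre[OF V(1)] by blast
  qed
qed (use f in auto)

text \<open>The limit of the sets \<open>F w\<close> along \<open>\<mu>\<close> in the Vietoris space.\<close>

definition limit_set :: "'x topology \<Rightarrow> 'w set \<Rightarrow> ('w \<Rightarrow> 'x set) \<Rightarrow> 'w set set \<Rightarrow> 'x set" where
  "limit_set X W F \<mu> =
     {x \<in> topspace X. \<forall>V. clopenin X V \<and> x \<in> V \<longrightarrow> {w \<in> W. F w \<inter> V \<noteq> {}} \<in> \<mu>}"

text \<open>If no point of \<open>V\<close> were in the limit, each would have a clopen
  neighbourhood that \<open>F w\<close> meets only for a set of \<open>w\<close> outside \<mu>. By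
  compactness finitely many of these cover \<open>V\<close>, and an ultrafilter that contains a
  finite union contains one of its members.\<close>

lemma limit_set_meets_iff:
  assumes X: "Boolean_space X" and \<mu>: "ultrafilter_on W \<mu>" and V: "clopenin X V"
  shows "limit_set X W F \<mu> \<inter> V \<noteq> {} \<longleftrightarrow> {w \<in> W. F w \<inter> V \<noteq> {}} \<in> \<mu>"
proof
  assume R: "{w \<in> W. F w \<inter> V \<noteq> {}} \<in> \<mu>"
  show "limit_set X W F \<mu> \<inter> V \<noteq> {}"
  proof
    assume "limit_set X W F \<mu> \<inter> V = {}"
    then have "\<exists>U. clopenin X U \<and> x \<in> U \<and> {w \<in> W. F w \<inter> U \<noteq> {}} \<notin> \<mu>" if "x \<in> V" for x
      using that clopenin_subset[OF V] unfolding limit_set_def by blast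
    then obtain U where U: "\<And>x. x \<in> V \<Longrightarrow> clopenin X (U x) \<and> x \<in> U x \<and> {w \<in> W. F w \<inter> U x \<noteq> {}} \<notin> \<mu>"
      by metis
    have "compactin X V"
      using X V by (simp add: Boolean_space_def clopenin_def closedin_compact_space)
    moreover have "\<forall>T\<in>U ` V. openin X T" "V \<subseteq> \<Union>(U ` V)"
      using U by (auto simp: clopenin_def)
    ultimately obtain \<T> where "finite \<T>" "\<T> \<subseteq> U ` V" "V \<subseteq> \<Union>\<T>"
      unfolding compactin_def by metis
    then obtain I where I: "finite I" "I \<subseteq> V" "V \<subseteq> (\<Union>x\<in>I. U x)"
      by (metis finite_subset_image)
    have "(\<Union>x\<in>I. {w \<in> W. F w \<inter> U x \<noteq> {}}) \<in> \<mu>"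
      by (rule ultrafilter_on_mono[OF \<mu> R]) (use I(3) in blast)+
    then have "\<exists>x\<in>I. {w \<in> W. F w \<inter> U x \<noteq> {}} \<in> \<mu>"
      by (subst (asm) ultrafilter_on_UN_iff[OF \<mu> I(1)]) auto
    then show False
      using I(2) U by blast
  qed
qed (use V in \<open>auto simp: limit_set_def\<close>)

lemma stone_cech_extension:
  assumes X: "Boolean_space X" and h: "\<And>w. w \<in> W \<Longrightarrow> h w \<in> topspace X"
  obtains f where "continuous_map (stone_cech W) X f" "\<forall>w\<in>W. f (principal_uf W w) = h w"
proof -
  \<comment> \<open>Points are treated as singletons. Any point of the limit set serves, since
    \<open>pre_iff\<close> shows that \<mu> decides which clopen sets contain it; Hausdorffness then
    identifies the value at a principal ultrafilter.\<close>
  define f where "f \<mu> = (SOME x. x \<in> limit_set X W (\<lambda>w. {h w}) \<mu>)" for \<mu>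
  have f: "f \<mu> \<in> limit_set X W (\<lambda>w. {h w}) \<mu>" if \<mu>: "ultrafilter_on W \<mu>" for \<mu>
  proof -
    have "{w \<in> W. {h w} \<inter> topspace X \<noteq> {}} = W"
      using h by auto
    then have "limit_set X W (\<lambda>w. {h w}) \<mu> \<inter> topspace X \<noteq> {}"
      using \<mu> by (simp add: limit_set_meets_iff[OF X \<mu> clopenin_topspace] ultrafilter_on_def)
    then show ?thesis
      unfolding f_def by (meson Int_emptyI someI_ex)
  qed
  have pre: "{w \<in> W. h w \<in> V} \<in> \<mu>" if "ultrafilter_on W \<mu>" "clopenin X V" "f \<mu> \<in> V" for \<mu> V
    using f[OF that(1)] that by (simp add: limit_set_def)
  have pre_iff: "f \<mu> \<in> V \<longleftrightarrow> {w \<in> W. h w \<in> V} \<in> \<mu>" if \<mu>: "ultrafilter_on W \<mu>" and V: "clopenin X V" for \<mu> V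
  proof
    assume hV: "{w \<in> W. h w \<in> V} \<in> \<mu>"
    show "f \<mu> \<in> V"
    proof (rule ccontr)
      assume "f \<mu> \<notin> V"
      then have "f \<mu> \<in> topspace X - V"
        using f[OF \<mu>] by (auto simp: limit_set_def)
      then have "{w \<in> W. h w \<in> topspace X - V} \<in> \<mu>"
        using pre \<mu> V clopenin_Diff by blast
      moreover have "{w \<in> W. h w \<in> topspace X - V} = W - {w \<in> W. h w \<in> V}"
        using h by auto
      ultimately show False
        using hV ultrafilter_on_Diff_iff[OF \<mu>, of "{w \<in> W. h w \<in> V}"] by auto
    qed
  qed (use pre \<mu> V in blast)
  have "continuous_map (stone_cech W) X f"
  proof (rule continuous_map_Boolean_space[OF X])
    fix V assume V: "clopenin X V"
    have "{\<mu> \<in> topspace (stone_cech W). f \<mu> \<in> V} = hat W {w \<in> W. h w \<in> V}"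
      using pre_iff[OF _ V] by (auto simp: hat_def topspace_stone_cech)
    then show "openin (stone_cech W) {\<mu> \<in> topspace (stone_cech W). f \<mu> \<in> V}"
      by (simp add: openin_hat)
  qed (use f in \<open>auto simp: topspace_stone_cech limit_set_def\<close>)
  moreover have "f (principal_uf W w) = h w" if w: "w \<in> W" for w
  proof (rule ccontr)
    assume ne: "f (principal_uf W w) \<noteq> h w"
    let ?\<mu> = "principal_uf W w"
    have u: "ultrafilter_on W ?\<mu>"
      using w by (rule ultrafilter_on_principal_uf)
    have "f ?\<mu> \<in> topspace X"
      using f[OF u] by (simp add: limit_set_def)
    moreover have "Hausdorff_space X"
      using X by (simp add: Boolean_space_def)
    ultimately obtain U where U: "openin X U" "f ?\<mu> \<in> U" "h w \<notin> U"
      using ne h[OF w] unfolding Hausdorff_space_def disjnt_def by blast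
    obtain V where V: "clopenin X V" "f ?\<mu> \<in> V" "V \<subseteq> U"
      using Boolean_space_clopen_nbhd[OF X U(1,2)] by blast
    then have "h w \<in> V"
      using pre[OF u V(1,2)] by (simp add: principal_uf_def)
    then show False
      using U V by blast
  qed
  ultimately show ?thesis
    using that by blast
qed

section \<open>The Vietoris space\<close>

lemma topspace_vietoris: "topspace (vietoris X) = vietoris_points X"
proof
  show "topspace (vietoris X) \<subseteq> vietoris_points X"
    unfolding vietoris_def topology_generated_by_topspace by auto
  have "openin (vietoris X) {K \<in> vietoris_points X. K \<subseteq> topspace X}"
    unfolding vietoris_def by (rule topology_generated_by_Basis) (use clopenin_topspace in blast)
  then have "{K \<in> vietoris_points X. K \<subseteq> topspace X} \<subseteq> topspace (vietoris X)"
    by (rule openin_subset)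
  then show "vietoris_points X \<subseteq> topspace (vietoris X)"
    by (auto simp: vietoris_points_def closedin_def)
qed

text \<open>The complement of \<Diamond>\<open>V\<close> is \<box> of the complement of
  \<open>V\<close>, which is again a generator.\<close>

lemma clopenin_vietoris_meets:
  assumes "clopenin X V"
  shows "clopenin (vietoris X) {K \<in> vietoris_points X. K \<inter> V \<noteq> {}}"
proof -
  have "openin (vietoris X) {K \<in> vietoris_points X. K \<inter> V \<noteq> {}}"
    unfolding vietoris_def by (rule topology_generated_by_Basis) (use assms in blast)
  moreover have "openin (vietoris X) {K \<in> vietoris_points X. K \<subseteq> topspace X - V}"
    unfolding vietoris_def by (rule topology_generated_by_Basis) (use assms clopenin_Diff in blast)
  moreover have "{K \<in> vietoris_points X. K \<subseteq> topspace X - V} =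
      topspace (vietoris X) - {K \<in> vietoris_points X. K \<inter> V \<noteq> {}}"
    unfolding topspace_vietoris by (auto simp: vietoris_points_def closedin_def)
  ultimately show ?thesis
    unfolding clopenin_def closedin_def by (auto simp: topspace_vietoris)
qed

text \<open>Asking for clopen preimages of the sets \<Diamond>\<open>V\<close> takes care of the
  sets \<box>\<open>V\<close> as well, by complementation.\<close>

lemma continuous_map_vietoris:
  assumes k: "\<And>x. x \<in> topspace T \<Longrightarrow> k x \<in> vietoris_points X"
    and meets: "\<And>V. clopenin X V \<Longrightarrow> clopenin T {x \<in> topspace T. k x \<inter> V \<noteq> {}}"
  shows "continuous_map T (vietoris X) k"
  unfolding vietoris_def
proof (rule continuous_on_generated_topo)
  fix U assume "U \<in> {{K \<in> vietoris_points X. K \<subseteq> V} |V. clopenin X V} \<union>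
      {{K \<in> vietoris_points X. K \<inter> V \<noteq> {}} |V. clopenin X V}"
  then consider V where "clopenin X V" "U = {K \<in> vietoris_points X. K \<subseteq> V}"
    | V where "clopenin X V" "U = {K \<in> vietoris_points X. K \<inter> V \<noteq> {}}"
    by blast
  then show "openin T (k -` U \<inter> topspace T)"
  proof cases
    case (1 V)
    have "k -` U \<inter> topspace T = topspace T - {x \<in> topspace T. k x \<inter> (topspace X - V) \<noteq> {}}"
      using k 1(2) clopenin_subset[OF 1(1)] by (fastforce simp: vietoris_points_def closedin_def)
    then show ?thesis
      using meets[OF clopenin_Diff[OF 1(1)]] by (simp add: clopenin_def openin_diff)
  next
    case (2 V)
    have "k -` U \<inter> topspace T = {x \<in> topspace T. k x \<inter> V \<noteq> {}}"
      using k 2(2) by auto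
    then show ?thesis
      using meets[OF 2(1)] by (simp add: clopenin_def)
  qed
next
  show "k ` topspace T \<subseteq> \<Union> ({{K \<in> vietoris_points X. K \<subseteq> V} |V. clopenin X V} \<union>
      {{K \<in> vietoris_points X. K \<inter> V \<noteq> {}} |V. clopenin X V})"
    using k unfolding topology_generated_by_topspace[symmetric] vietoris_def[symmetric]
      topspace_vietoris by blast
qed

lemma stone_cech_extension_vietoris:
  assumes X: "Boolean_space X" and F: "\<And>w. w \<in> W \<Longrightarrow> F w \<in> vietoris_points X"
  obtains k where "continuous_map (stone_cech W) (vietoris X) k"
    "\<forall>w\<in>W. k (principal_uf W w) = F w"
proof -
  let ?k = "limit_set X W F"
  have "continuous_map (stone_cech W) (vietoris X) ?k"
  proof (rule continuous_map_vietoris)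
    fix V assume V: "clopenin X V"
    have "{\<mu> \<in> topspace (stone_cech W). ?k \<mu> \<inter> V \<noteq> {}} = hat W {w \<in> W. F w \<inter> V \<noteq> {}}"
      using limit_set_meets_iff[OF X _ V] by (auto simp: topspace_stone_cech hat_def)
    then show "clopenin (stone_cech W) {\<mu> \<in> topspace (stone_cech W). ?k \<mu> \<inter> V \<noteq> {}}"
      by (simp add: clopenin_hat)
  next
    fix \<mu> assume "\<mu> \<in> topspace (stone_cech W)"
    then have \<mu>: "ultrafilter_on W \<mu>"
      by (simp add: topspace_stone_cech)
    have "{w \<in> W. F w \<inter> topspace X \<noteq> {}} = W"
      using F by (auto simp: vietoris_points_def closedin_def)
    then have "?k \<mu> \<noteq> {}"
      using limit_set_meets_iff[OF X \<mu> clopenin_topspace, of F] \<mu> by (auto simp: ultrafilter_on_def)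
    moreover have "openin X (topspace X - ?k \<mu>)"
    proof (subst openin_subopen, intro ballI)
      fix x assume x: "x \<in> topspace X - ?k \<mu>"
      then obtain V where V: "clopenin X V" "x \<in> V" "{w \<in> W. F w \<inter> V \<noteq> {}} \<notin> \<mu>"
        unfolding limit_set_def by blast
      \<comment> \<open>A clopen set that witnesses that one point is outside the limit misses the
        whole limit, by \<open>limit_set_meets_iff\<close>; hence the limit is closed.\<close>
      then have "V \<subseteq> topspace X - ?k \<mu>"
        using clopenin_subset[OF V(1)] limit_set_meets_iff[OF X \<mu> V(1), of F] by blast
      then show "\<exists>T. openin X T \<and> x \<in> T \<and> T \<subseteq> topspace X - ?k \<mu>"
        using V by (auto simp: clopenin_def)
    qed
    ultimately show "?k \<mu> \<in> vietoris_points X"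
      unfolding vietoris_points_def closedin_def by (auto simp: limit_set_def)
  qed
  moreover have "?k (principal_uf W w) = F w" if w: "w \<in> W" for w
  proof -
    have mem: "x \<in> ?k (principal_uf W w) \<longleftrightarrow>
        x \<in> topspace X \<and> (\<forall>V. clopenin X V \<and> x \<in> V \<longrightarrow> F w \<inter> V \<noteq> {})" for x
      using w by (auto simp: limit_set_def principal_uf_def)
    have cl: "closedin X (F w)"
      using F[OF w] by (simp add: vietoris_points_def)
    have "x \<in> F w" if "x \<in> ?k (principal_uf W w)" for x
    proof (rule ccontr)
      assume "x \<notin> F w"
      then have "x \<in> topspace X - F w"
        using that mem by blast
      then obtain V where "clopenin X V" "x \<in> V" "V \<subseteq> topspace X - F w"
        using Boolean_space_clopen_nbhd[OF X] cl unfolding closedin_def by metis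
      then show False
        using that mem by blast
    qed
    then show ?thesis
      using mem closedin_subset[OF cl] by blast
  qed
  ultimately show ?thesis
    using that by blast
qed

text \<open>Keeps the mark \<open>1\<close> in the alphabet \<open>A \<times> {0, 1}\<close> from
  being rewritten to \<open>Suc 0\<close>.\<close>

declare One_nat_def [simp del]

section \<open>Recognition by semigroup homomorphisms\<close>

definition word_hom :: "'a set \<Rightarrow> 'y internal_sgp \<Rightarrow> ('a list \<Rightarrow> 'y) \<Rightarrow> bool" where
  "word_hom A \<Y> h \<longleftrightarrow> (\<forall>w\<in>words A. h w \<in> sgp \<Y>) \<and>
     (\<forall>u\<in>words A. \<forall>v\<in>words A. h (u @ v) = mult \<Y> (h u) (h v))"

lemma word_hom_mem: "word_hom A \<Y> h \<Longrightarrow> w \<in> words A \<Longrightarrow> h w \<in> sgp \<Y>"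
  by (simp add: word_hom_def)

lemma word_hom_append:
  "word_hom A \<Y> h \<Longrightarrow> u \<in> words A \<Longrightarrow> v \<in> words A \<Longrightarrow> h (u @ v) = mult \<Y> (h u) (h v)"
  by (simp add: word_hom_def)

lemma append_words: "u \<in> words A \<Longrightarrow> v \<in> words A \<Longrightarrow> u @ v \<in> words A"
  by (auto simp: words_def)

text \<open>\<open>generator\<close> returns the word behind a principal ultrafilter, so being
  multiplicative on principal ultrafilters is being multiplicative on words.\<close>

lemma internal_sgp_morphism_beta_words_iff:
  "internal_sgp_morphism (beta_words A) \<Y> f \<longleftrightarrow>
     continuous_map (stone_cech (words A)) (space_of \<Y>) f \<and>
     word_hom A \<Y> (\<lambda>w. f (principal_uf (words A) w))"
  by (auto simp: internal_sgp_morphism_def beta_words_def Let_def word_hom_def)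

text \<open>Evaluating the equation for \<open>hat (words A) L\<close> at principal ultrafilters
  recovers \<open>L\<close> itself.\<close>

lemma recognisedE:
  assumes "L \<in> recognised \<Y> A"
  obtains f C where "continuous_map (stone_cech (words A)) (space_of \<Y>) f"
    "word_hom A \<Y> (\<lambda>w. f (principal_uf (words A) w))" "clopenin (space_of \<Y>) C"
    "hat (words A) L = {\<mu> \<in> topspace (stone_cech (words A)). f \<mu> \<in> C}"
    "L = {w \<in> words A. f (principal_uf (words A) w) \<in> C}"
proof -
  obtain f C where L: "L \<subseteq> words A" and f: "internal_sgp_morphism (beta_words A) \<Y> f"
    and C: "clopenin (space_of \<Y>) C"
    and "hat (words A) L = {\<mu> \<in> topspace (space_of (beta_words A)). f \<mu> \<in> C}"
    using assms by (auto simp: recognised_def)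
  then have hat: "hat (words A) L = {\<mu> \<in> topspace (stone_cech (words A)). f \<mu> \<in> C}"
    by (simp add: beta_words_def Let_def)
  have "w \<in> L \<longleftrightarrow> f (principal_uf (words A) w) \<in> C" if "w \<in> words A" for w
    using principal_uf_in_hat_iff[OF that L] that
    by (simp add: hat topspace_stone_cech ultrafilter_on_principal_uf)
  then have "L = {w \<in> words A. f (principal_uf (words A) w) \<in> C}"
    using L by blast
  then show ?thesis
    using that[OF _ _ C hat] f internal_sgp_morphism_beta_words_iff by blast
qed

lemma recognised_homE:
  assumes "L \<in> recognised \<Y> A"
  obtains h C where "L = {w \<in> words A. h w \<in> C}" "word_hom A \<Y> h" "clopenin (space_of \<Y>) C"
  using assms by (rule recognisedE) (rule that)

lemma recognisedI:
  assumes f: "continuous_map (stone_cech (words A)) (space_of \<Y>) f"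
    and eq: "\<And>w. w \<in> words A \<Longrightarrow> f (principal_uf (words A) w) = h w"
    and h: "word_hom A \<Y> h" and C: "clopenin (space_of \<Y>) C"
  shows "{w \<in> words A. h w \<in> C} \<in> recognised \<Y> A"
proof -
  have "word_hom A \<Y> (\<lambda>w. f (principal_uf (words A) w))"
    using h by (simp add: word_hom_def eq append_words)
  then have "internal_sgp_morphism (beta_words A) \<Y> f"
    using f by (simp add: internal_sgp_morphism_beta_words_iff)
  moreover have "{w \<in> words A. f (principal_uf (words A) w) \<in> C} = {w \<in> words A. h w \<in> C}"
    using eq by auto
  then have "hat (words A) {w \<in> words A. h w \<in> C} =
      {\<mu> \<in> topspace (space_of (beta_words A)). f \<mu> \<in> C}"
    using clopen_preimage_eq_hat[OF f C] by (simp add: beta_words_def Let_def)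
  ultimately show ?thesis
    using C unfolding recognised_def by auto
qed

section \<open>Homomorphisms given on letters, and marked words\<close>

text \<open>The homomorphism from the free semigroup that extends \<open>c\<close>. There is no unit
  to serve as a value at \<open>[]\<close>, so the recursion stops at one-letter words;
  \<open>words\<close> excludes \<open>[]\<close>.\<close>

fun letter_hom :: "('y \<Rightarrow> 'y \<Rightarrow> 'y) \<Rightarrow> ('a \<Rightarrow> 'y) \<Rightarrow> 'a list \<Rightarrow> 'y" where
  "letter_hom m c [] = undefined"
| "letter_hom m c [a] = c a"
| "letter_hom m c (a # b # w) = m (c a) (letter_hom m c (b # w))"

lemma letter_hom_Cons: "w \<noteq> [] \<Longrightarrow> letter_hom m c (a # w) = m (c a) (letter_hom m c w)"
  by (cases w) auto

abbreviation unmarked :: "'a list \<Rightarrow> ('a \<times> nat) list" where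
  "unmarked \<equiv> map (\<lambda>a. (a, 0))"

text \<open>The mark falls into exactly one of the two factors. Under a homomorphism this case
  distinction becomes the union in the multiplication of \<open>\<Diamond>S\<close>.\<close>

lemma gamma1_append:
  "gamma1 (u @ v, i) = (if i < length u then gamma1 (u, i) @ unmarked v
     else unmarked u @ gamma1 (v, i - length u))"
  by (rule nth_equalityI) (auto simp: gamma1_def nth_append)

lemma gamma1_in_words: "w \<in> words A \<Longrightarrow> gamma1 (w, i) \<in> words (A \<times> {0, 1})"
  by (fastforce simp: gamma1_def words_def in_lists_conv_set)

lemma unmarked_in_words: "w \<in> words A \<Longrightarrow> unmarked w \<in> words (A \<times> {0, 1})"
  by (auto simp: words_def)

lemma exists_lang_preimage:
  "exists_lang A {w \<in> words (A \<times> {0, 1}). g w \<in> V} =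
     {w \<in> words A. \<exists>i<length w. g (gamma1 (w, i)) \<in> V}"
  by (auto simp: exists_lang_def marked_words_def gamma1_in_words simp del: insert_iff)
    (use gamma1_in_words in \<open>fastforce simp: image_iff\<close>)

lemma words_induct [consumes 1, case_names single Cons]:
  assumes "w \<in> words A" "\<And>a. a \<in> A \<Longrightarrow> P [a]"
    "\<And>a w. a \<in> A \<Longrightarrow> w \<in> words A \<Longrightarrow> P w \<Longrightarrow> P (a # w)"
  shows "P w"
  using assms(1)
proof (induction w)
  case (Cons a w)
  then show ?case
    using assms(2,3) by (cases "w = []") (auto simp: words_def)
qed (simp add: words_def)

section \<open>Algebras of languages\<close>

text \<open>\<open>Pow W\<close> is one of the algebras intersected, which keeps the hull inside
  \<open>Pow W\<close>; the remaining closure properties pass to intersections.\<close>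

lemma algebra_hull:
  assumes "S \<subseteq> Pow W"
  shows "algebra W (algebra W hull S)"
proof -
  have "Pow W \<in> {t. algebra W t \<and> S \<subseteq> t}"
    using assms by (simp add: algebra_Pow)
  then have "\<Inter>{t. algebra W t \<and> S \<subseteq> t} \<subseteq> Pow W"
    by (rule Inter_lower)
  then show ?thesis
    unfolding hull_def algebra_iff_Un by simp
qed

text \<open>Quotients commute with complements and unions, so the languages whose quotients all lie
  in the hull form an algebra. It contains the generators, hence the hull.\<close>

lemma quotient_closed_algebra_hull:
  assumes S: "S \<subseteq> Pow (words A)"
    and q: "\<And>L u. L \<in> S \<Longrightarrow> u \<in> words A \<Longrightarrow>
      {v \<in> words A. u @ v \<in> L} \<in> algebra (words A) hull S \<and>
      {v \<in> words A. v @ u \<in> L} \<in> algebra (words A) hull S"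
  shows "quotient_closed A (algebra (words A) hull S)"
proof -
  let ?H = "algebra (words A) hull S"
  interpret H: algebra "words A" ?H
    using S by (rule algebra_hull)
  define Q where "Q = {L \<in> ?H. \<forall>u\<in>words A. {v \<in> words A. u @ v \<in> L} \<in> ?H \<and> {v \<in> words A. v @ u \<in> L} \<in> ?H}"
  have "algebra (words A) Q"
    unfolding algebra_iff_Un
  proof (intro conjI ballI)
    show "Q \<subseteq> Pow (words A)"
      using H.space_closed by (auto simp: Q_def)
    show "{} \<in> Q" by (simp add: Q_def)
  next
    fix L assume L: "L \<in> Q"
    have "{v \<in> words A. u @ v \<in> words A - L} = words A - {v \<in> words A. u @ v \<in> L}"
      "{v \<in> words A. v @ u \<in> words A - L} = words A - {v \<in> words A. v @ u \<in> L}" if "u \<in> words A" for u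
      using that append_words by auto
    then show "words A - L \<in> Q"
      using L by (auto simp: Q_def simp del: Diff_iff)
  next
    fix L M assume "L \<in> Q" "M \<in> Q"
    moreover have "{v \<in> words A. u @ v \<in> L \<union> M} = {v \<in> words A. u @ v \<in> L} \<union> {v \<in> words A. u @ v \<in> M}"
      "{v \<in> words A. v @ u \<in> L \<union> M} = {v \<in> words A. v @ u \<in> L} \<union> {v \<in> words A. v @ u \<in> M}" for u
      by auto
    ultimately show "L \<union> M \<in> Q"
      by (auto simp: Q_def simp del: Un_iff)
  qed
  moreover have "S \<subseteq> Q"
    using q hull_subset[of S] by (fastforce simp: Q_def)
  ultimately have "?H \<subseteq> Q"
    by (simp add: hull_minimal)
  then show ?thesis
    by (auto simp: quotient_closed_def Q_def)
qed

section \<open>The unary Schutzenberger product\<close>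

lemma clopenin_Times:
  "clopenin X U \<Longrightarrow> clopenin Y V \<Longrightarrow> clopenin (prod_topology X Y) (U \<times> V)"
  by (simp add: clopenin_def openin_prod_Times_iff closedin_prod_Times_iff)

lemma word_hom_schutzenberger_iff:
  "word_hom A (schutzenberger \<X>) (\<lambda>w. (F w, g w)) \<longleftrightarrow>
     word_hom A \<X> g \<and> (\<forall>w\<in>words A. finite (F w) \<and> F w \<noteq> {} \<and> F w \<subseteq> sgp \<X>) \<and>
     (\<forall>u\<in>words A. \<forall>v\<in>words A.
        F (u @ v) = (\<lambda>p. mult \<X> p (g v)) ` F u \<union> mult \<X> (g u) ` F v)"
  by (auto simp: word_hom_def schutzenberger_def)

text \<open>The preimages of \<Diamond>\<open>V\<close> \<times> \<open>X\<close>. As in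
  \<open>recognised\<close>, the homomorphism may vary with the language.\<close>

definition meeting_langs :: "'x internal_sgp \<Rightarrow> 'a set \<Rightarrow> 'a list set set" where
  "meeting_langs \<X> A = {{w \<in> words A. F w \<inter> V \<noteq> {}} |F g V.
     word_hom A (schutzenberger \<X>) (\<lambda>w. (F w, g w)) \<and> clopenin (space_of \<X>) V}"

lemma meeting_langsI:
  "word_hom A (schutzenberger \<X>) (\<lambda>w. (F w, g w)) \<Longrightarrow> clopenin (space_of \<X>) V \<Longrightarrow>
     {w \<in> words A. F w \<inter> V \<noteq> {}} \<in> meeting_langs \<X> A"
  unfolding meeting_langs_def by blast

lemma recognised_subset_Pow: "recognised \<Y> A \<subseteq> Pow (words A)"
  by (auto simp: recognised_def)

lemma meeting_langs_subset_Pow: "meeting_langs \<X> A \<subseteq> Pow (words A)"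
  by (auto simp: meeting_langs_def)

context Boolean_space_internal_semigroup
begin

section \<open>Languages recognised by the product in terms of its two components\<close>

lemma recognised_homI:
  assumes h: "word_hom A \<X> h" and C: "clopenin (space_of \<X>) C"
  shows "{w \<in> words A. h w \<in> C} \<in> recognised \<X> A"
proof -
  have "h w \<in> topspace (space_of \<X>)" if "w \<in> words A" for w
    using word_hom_mem[OF h that] sgp_subset by blast
  then obtain f where "continuous_map (stone_cech (words A)) (space_of \<X>) f"
    "\<forall>w\<in>words A. f (principal_uf (words A) w) = h w"
    by (rule stone_cech_extension[OF Boolean])
  then show ?thesis
    using recognisedI[OF _ _ h C] by blast
qed

lemma schutzenberger_hom_points:
  assumes h: "word_hom A (schutzenberger \<X>) (\<lambda>w. (F w, g w))" and w: "w \<in> words A"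
  shows "F w \<in> vietoris_points (space_of \<X>)" "g w \<in> topspace (space_of \<X>)"
proof -
  have "finite (F w)" "F w \<noteq> {}" "F w \<subseteq> sgp \<X>" and g: "word_hom A \<X> g"
    using h w by (simp_all add: word_hom_schutzenberger_iff)
  then show "F w \<in> vietoris_points (space_of \<X>)"
    using sgp_subset Boolean closedin_Hausdorff_finite[of "space_of \<X>" "F w"]
    by (auto simp: vietoris_points_def Boolean_space_def)
  show "g w \<in> topspace (space_of \<X>)"
    using word_hom_mem[OF g w] sgp_subset by blast
qed

lemma recognised_schutzenberger_homI:
  assumes h: "word_hom A (schutzenberger \<X>) (\<lambda>w. (F w, g w))"
    and C: "clopenin (space_of (schutzenberger \<X>)) C"
  shows "{w \<in> words A. (F w, g w) \<in> C} \<in> recognised (schutzenberger \<X>) A"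
proof -
  obtain k where k: "continuous_map (stone_cech (words A)) (vietoris (space_of \<X>)) k"
    "\<forall>w\<in>words A. k (principal_uf (words A) w) = F w"
    by (rule stone_cech_extension_vietoris[OF Boolean schutzenberger_hom_points(1)[OF h]])
  obtain f where f: "continuous_map (stone_cech (words A)) (space_of \<X>) f"
    "\<forall>w\<in>words A. f (principal_uf (words A) w) = g w"
    by (rule stone_cech_extension[OF Boolean schutzenberger_hom_points(2)[OF h]])
  have "continuous_map (stone_cech (words A)) (space_of (schutzenberger \<X>)) (\<lambda>\<mu>. (k \<mu>, f \<mu>))"
    using k(1) f(1) by (simp add: schutzenberger_def continuous_map_paired)
  then show ?thesis
    by (rule recognisedI[OF _ _ h C]) (simp add: k f)
qed

lemma meeting_langs_subset_recognised: "meeting_langs \<X> A \<subseteq> recognised (schutzenberger \<X>) A"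
proof
  fix L assume "L \<in> meeting_langs \<X> A"
  then obtain F g V where L: "L = {w \<in> words A. F w \<inter> V \<noteq> {}}"
    and h: "word_hom A (schutzenberger \<X>) (\<lambda>w. (F w, g w))" and V: "clopenin (space_of \<X>) V"
    unfolding meeting_langs_def by blast
  let ?C = "{K \<in> vietoris_points (space_of \<X>). K \<inter> V \<noteq> {}} \<times> topspace (space_of \<X>)"
  have "clopenin (space_of (schutzenberger \<X>)) ?C"
    using clopenin_Times[OF clopenin_vietoris_meets[OF V] clopenin_topspace]
    by (simp add: schutzenberger_def)
  then have "{w \<in> words A. (F w, g w) \<in> ?C} \<in> recognised (schutzenberger \<X>) A"
    by (rule recognised_schutzenberger_homI[OF h])
  moreover have "{w \<in> words A. (F w, g w) \<in> ?C} = L"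
    using schutzenberger_hom_points[OF h] unfolding L by auto
  ultimately show "L \<in> recognised (schutzenberger \<X>) A"
    by simp
qed

lemma recognised_subset_recognised_schutzenberger:
  "recognised \<X> A \<subseteq> recognised (schutzenberger \<X>) A"
proof
  fix L assume "L \<in> recognised \<X> A"
  then obtain g V where L: "L = {w \<in> words A. g w \<in> V}" and g: "word_hom A \<X> g"
    and V: "clopenin (space_of \<X>) V"
    by (rule recognised_homE)
  \<comment> \<open>With singletons both halves of the union in the product are the same one-point
    set, and \<open>{g w}\<close> meets \<open>V\<close> exactly when \<open>g w\<close> lies in
    \<open>V\<close>.\<close>
  have "word_hom A (schutzenberger \<X>) (\<lambda>w. ({g w}, g w))"
    unfolding word_hom_schutzenberger_iff
    using g by (auto simp: word_hom_mem word_hom_append[OF g])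
  then have "{w \<in> words A. {g w} \<inter> V \<noteq> {}} \<in> meeting_langs \<X> A"
    using V by (rule meeting_langsI)
  then show "L \<in> recognised (schutzenberger \<X>) A"
    using meeting_langs_subset_recognised L by auto
qed

text \<open>The map \<open>f\<close> stays continuous when its source carries the coarser topology
  given by the hull. Hence \<open>hat ?W L\<close> is open there, and
  \<open>hat_open_imp_mem\<close> places \<open>L\<close> in the hull; the clopen set
  \<open>C\<close> never has to be decomposed.\<close>

lemma recognised_schutzenberger_subset_hull:
  "recognised (schutzenberger \<X>) A \<subseteq> algebra (words A) hull (recognised \<X> A \<union> meeting_langs \<X> A)"
proof
  let ?W = "words A" and ?X = "space_of \<X>"
  let ?B = "algebra ?W hull (recognised \<X> A \<union> meeting_langs \<X> A)"
  let ?T = "hat_topology ?W ?B"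
  fix L assume L: "L \<in> recognised (schutzenberger \<X>) A"
  have B: "algebra ?W ?B"
    by (intro algebra_hull Un_least recognised_subset_Pow meeting_langs_subset_Pow)
  obtain f C where f: "continuous_map (stone_cech ?W) (space_of (schutzenberger \<X>)) f"
    and hom: "word_hom A (schutzenberger \<X>) (\<lambda>w. f (principal_uf ?W w))"
    and C: "clopenin (space_of (schutzenberger \<X>)) C"
    and hat: "hat ?W L = {\<mu> \<in> topspace (stone_cech ?W). f \<mu> \<in> C}"
    using L by (rule recognisedE)
  have f1: "continuous_map (stone_cech ?W) (vietoris ?X) (fst \<circ> f)"
    and f2: "continuous_map (stone_cech ?W) ?X (snd \<circ> f)"
    using f by (simp_all add: schutzenberger_def continuous_map_pairwise)
  have hom': "word_hom A (schutzenberger \<X>) (\<lambda>w. (fst (f (principal_uf ?W w)), snd (f (principal_uf ?W w))))"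
    using hom by simp
  then have hom2: "word_hom A \<X> (\<lambda>w. snd (f (principal_uf ?W w)))"
    by (subst (asm) word_hom_schutzenberger_iff) simp
  have T: "topspace ?T = topspace (stone_cech ?W)"
    by (simp add: topspace_hat_topology[OF B] topspace_stone_cech)
  have points: "fst (f \<mu>) \<in> vietoris_points ?X" if "\<mu> \<in> topspace (stone_cech ?W)" for \<mu>
    using f1 that by (auto simp: continuous_map_def topspace_vietoris)
  \<comment> \<open>Preimages are computed in the Stone-Cech topology, where they are
    \<open>hat ?W\<close> of a meeting language. As that language is in \<open>?B\<close>, they are
    clopen for \<open>?T\<close> too.\<close>
  have "continuous_map ?T (vietoris ?X) (fst \<circ> f)"
  proof (rule continuous_map_vietoris)
    fix V assume V: "clopenin ?X V"
    have "principal_uf ?W w \<in> topspace (stone_cech ?W)" if "w \<in> ?W" for w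
      using that by (simp add: topspace_stone_cech ultrafilter_on_principal_uf)
    then have "{\<mu> \<in> topspace ?T. (fst \<circ> f) \<mu> \<inter> V \<noteq> {}} =
        hat ?W {w \<in> ?W. fst (f (principal_uf ?W w)) \<inter> V \<noteq> {}}"
      using clopen_preimage_eq_hat[OF f1 clopenin_vietoris_meets[OF V]] points
      by (simp add: T cong: conj_cong)
    moreover have "{w \<in> ?W. fst (f (principal_uf ?W w)) \<inter> V \<noteq> {}} \<in> ?B"
      using meeting_langsI[OF hom' V] hull_subset[of "recognised \<X> A \<union> meeting_langs \<X> A"] by blast
    ultimately show "clopenin ?T {\<mu> \<in> topspace ?T. (fst \<circ> f) \<mu> \<inter> V \<noteq> {}}"
      by (simp only: clopenin_hat_topology[OF B])
  qed (simp add: T points)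
  moreover have "continuous_map ?T ?X (snd \<circ> f)"
  proof (rule continuous_map_Boolean_space[OF Boolean])
    fix V assume V: "clopenin ?X V"
    have "{\<mu> \<in> topspace ?T. (snd \<circ> f) \<mu> \<in> V} = hat ?W {w \<in> ?W. snd (f (principal_uf ?W w)) \<in> V}"
      using clopen_preimage_eq_hat[OF f2 V] by (simp add: T)
    moreover have "{w \<in> ?W. snd (f (principal_uf ?W w)) \<in> V} \<in> ?B"
      using recognised_homI[OF hom2 V] hull_subset[of "recognised \<X> A \<union> meeting_langs \<X> A"] by blast
    ultimately show "openin ?T {\<mu> \<in> topspace ?T. (snd \<circ> f) \<mu> \<in> V}"
      using clopenin_hat_topology[OF B] by (simp only: clopenin_def)
  qed (use f2 in \<open>auto simp: T continuous_map_def\<close>)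
  ultimately have "continuous_map ?T (space_of (schutzenberger \<X>)) f"
    by (simp add: schutzenberger_def continuous_map_pairwise)
  then have "openin ?T (hat ?W L)"
    using C unfolding hat T[symmetric] clopenin_def by (blast intro: openin_continuous_map_preimage)
  moreover have "L \<subseteq> ?W"
    using L recognised_subset_Pow by blast
  ultimately show "L \<in> ?B"
    by (intro hat_open_imp_mem[OF B])
qed

lemma algebra_hull_recognised_schutzenberger:
  "algebra (words A) hull recognised (schutzenberger \<X>) A =
   algebra (words A) hull (recognised \<X> A \<union> meeting_langs \<X> A)"
proof
  show "algebra (words A) hull recognised (schutzenberger \<X>) A
      \<subseteq> algebra (words A) hull (recognised \<X> A \<union> meeting_langs \<X> A)"
    by (intro hull_minimal recognised_schutzenberger_subset_hull algebra_hull Un_least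
        recognised_subset_Pow meeting_langs_subset_Pow)
  show "algebra (words A) hull (recognised \<X> A \<union> meeting_langs \<X> A)
      \<subseteq> algebra (words A) hull recognised (schutzenberger \<X>) A"
    using recognised_subset_recognised_schutzenberger meeting_langs_subset_recognised
    by (intro hull_mono) blast
qed

section \<open>Closure under quotients\<close>

text \<open>The homomorphism is kept and the clopen set is pulled back along the continuous action
  of \<open>g u\<close>.\<close>

lemma recognised_quotient:
  assumes L: "L \<in> recognised \<X> A" and u: "u \<in> words A"
  shows "{v \<in> words A. u @ v \<in> L} \<in> recognised \<X> A" "{v \<in> words A. v @ u \<in> L} \<in> recognised \<X> A"
proof -
  let ?X = "space_of \<X>"
  obtain g V where L: "L = {w \<in> words A. g w \<in> V}" and g: "word_hom A \<X> g" and V: "clopenin ?X V"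
    using L by (rule recognised_homE)
  have gu: "g u \<in> sgp \<X>"
    using word_hom_mem[OF g u] .
  have gv: "g v \<in> sgp \<X>" "g v \<in> topspace ?X" if "v \<in> words A" for v
    using word_hom_mem[OF g that] sgp_subset by auto
  have "{v \<in> words A. u @ v \<in> L} = {v \<in> words A. g v \<in> {x \<in> topspace ?X. lact \<X> (g u) x \<in> V}}"
    using u gu gv by (auto simp: L append_words word_hom_append[OF g] lact_extends)
  then show "{v \<in> words A. u @ v \<in> L} \<in> recognised \<X> A"
    using recognised_homI[OF g clopenin_preimage[OF lact_continuous[OF gu] V]] by simp
  have "{v \<in> words A. v @ u \<in> L} = {v \<in> words A. g v \<in> {x \<in> topspace ?X. ract \<X> (g u) x \<in> V}}"
    using u gu gv by (auto simp: L append_words word_hom_append[OF g] ract_extends)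
  then show "{v \<in> words A. v @ u \<in> L} \<in> recognised \<X> A"
    using recognised_homI[OF g clopenin_preimage[OF ract_continuous[OF gu] V]] by simp
qed

text \<open>The union in the product rule for \<open>F (u @ v)\<close> splits the condition in two.
  The half with \<open>F u\<close> constrains only \<open>g v\<close> and gives a language
  recognised by \<open>\<X>\<close>; the half with \<open>F v\<close> gives a meeting language for a
  pulled-back clopen set.\<close>

lemma meeting_langs_quotient:
  assumes L: "L \<in> meeting_langs \<X> A" and u: "u \<in> words A"
  shows "\<exists>M\<in>recognised \<X> A. \<exists>N\<in>meeting_langs \<X> A. {v \<in> words A. u @ v \<in> L} = M \<union> N"
    and "\<exists>M\<in>recognised \<X> A. \<exists>N\<in>meeting_langs \<X> A. {v \<in> words A. v @ u \<in> L} = M \<union> N"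
proof -
  let ?X = "space_of \<X>"
  obtain F g V where L: "L = {w \<in> words A. F w \<inter> V \<noteq> {}}"
    and h: "word_hom A (schutzenberger \<X>) (\<lambda>w. (F w, g w))" and V: "clopenin ?X V"
    using L unfolding meeting_langs_def by blast
  have g: "word_hom A \<X> g" and F: "\<And>w. w \<in> words A \<Longrightarrow> finite (F w) \<and> F w \<subseteq> sgp \<X>"
    and app: "\<And>u v. u \<in> words A \<Longrightarrow> v \<in> words A \<Longrightarrow>
      F (u @ v) = (\<lambda>p. mult \<X> p (g v)) ` F u \<union> mult \<X> (g u) ` F v"
    using h unfolding word_hom_schutzenberger_iff by auto
  have gu: "g u \<in> sgp \<X>"
    using word_hom_mem[OF g u] .
  have gv: "g v \<in> sgp \<X>" "g v \<in> topspace ?X" if "v \<in> words A" for v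
    using word_hom_mem[OF g that] sgp_subset by auto
  have Fs: "s \<in> sgp \<X>" "s \<in> topspace ?X" if "v \<in> words A" "s \<in> F v" for v s
    using F[OF that(1)] that(2) sgp_subset by auto
  \<comment> \<open>Finiteness of \<open>F u\<close> keeps the union closed.\<close>
  have clopen: "clopenin ?X (\<Union>s\<in>F u. {x \<in> topspace ?X. lact \<X> s x \<in> V})"
    "clopenin ?X (\<Union>s\<in>F u. {x \<in> topspace ?X. ract \<X> s x \<in> V})"
    using F[OF u] V by (auto intro!: clopenin_UN clopenin_preimage lact_continuous ract_continuous)
  have "F (u @ v) \<inter> V \<noteq> {} \<longleftrightarrow> g v \<in> (\<Union>s\<in>F u. {x \<in> topspace ?X. lact \<X> s x \<in> V}) \<or>
      F v \<inter> {x \<in> topspace ?X. lact \<X> (g u) x \<in> V} \<noteq> {}" if v: "v \<in> words A" for v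
  proof -
    have "F (u @ v) \<inter> V \<noteq> {} \<longleftrightarrow> (\<exists>s\<in>F u. mult \<X> s (g v) \<in> V) \<or> (\<exists>t\<in>F v. mult \<X> (g u) t \<in> V)"
      unfolding app[OF u v] by blast
    then show ?thesis
      using Fs[OF u] Fs[OF v] gv[OF v] gu by (auto simp: lact_extends)
  qed
  then have "{v \<in> words A. F (u @ v) \<inter> V \<noteq> {}} = {v \<in> words A. g v \<in> (\<Union>s\<in>F u. {x \<in> topspace ?X. lact \<X> s x \<in> V}) \<or>
      F v \<inter> {x \<in> topspace ?X. lact \<X> (g u) x \<in> V} \<noteq> {}}"
    by (intro Collect_cong conj_cong refl)
  then have "{v \<in> words A. u @ v \<in> L} =
      {v \<in> words A. g v \<in> (\<Union>s\<in>F u. {x \<in> topspace ?X. lact \<X> s x \<in> V})} \<union>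
      {v \<in> words A. F v \<inter> {x \<in> topspace ?X. lact \<X> (g u) x \<in> V} \<noteq> {}}"
    using append_words[OF u] by (simp add: L conj_disj_distribL Collect_disj_eq cong: conj_cong)
  then show "\<exists>M\<in>recognised \<X> A. \<exists>N\<in>meeting_langs \<X> A. {v \<in> words A. u @ v \<in> L} = M \<union> N"
    using recognised_homI[OF g clopen(1)]
      meeting_langsI[OF h clopenin_preimage[OF lact_continuous[OF gu] V]] by blast
  have "F (v @ u) \<inter> V \<noteq> {} \<longleftrightarrow> g v \<in> (\<Union>s\<in>F u. {x \<in> topspace ?X. ract \<X> s x \<in> V}) \<or>
      F v \<inter> {x \<in> topspace ?X. ract \<X> (g u) x \<in> V} \<noteq> {}" if v: "v \<in> words A" for v
  proof -
    have "F (v @ u) \<inter> V \<noteq> {} \<longleftrightarrow> (\<exists>s\<in>F u. mult \<X> (g v) s \<in> V) \<or> (\<exists>t\<in>F v. mult \<X> t (g u) \<in> V)"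
      unfolding app[OF v u] by blast
    then show ?thesis
      using Fs[OF u] Fs[OF v] gv[OF v] gu by (auto simp: ract_extends)
  qed
  then have "{v \<in> words A. F (v @ u) \<inter> V \<noteq> {}} = {v \<in> words A. g v \<in> (\<Union>s\<in>F u. {x \<in> topspace ?X. ract \<X> s x \<in> V}) \<or>
      F v \<inter> {x \<in> topspace ?X. ract \<X> (g u) x \<in> V} \<noteq> {}}"
    by (intro Collect_cong conj_cong refl)
  then have "{v \<in> words A. v @ u \<in> L} =
      {v \<in> words A. g v \<in> (\<Union>s\<in>F u. {x \<in> topspace ?X. ract \<X> s x \<in> V})} \<union>
      {v \<in> words A. F v \<inter> {x \<in> topspace ?X. ract \<X> (g u) x \<in> V} \<noteq> {}}"
    using append_words[OF _ u] by (simp add: L conj_disj_distribL Collect_disj_eq cong: conj_cong)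
  then show "\<exists>M\<in>recognised \<X> A. \<exists>N\<in>meeting_langs \<X> A. {v \<in> words A. v @ u \<in> L} = M \<union> N"
    using recognised_homI[OF g clopen(2)]
      meeting_langsI[OF h clopenin_preimage[OF ract_continuous[OF gu] V]] by blast
qed

lemma quotient_closed_meeting_hull:
  "quotient_closed A (algebra (words A) hull (recognised \<X> A \<union> meeting_langs \<X> A))"
proof (rule quotient_closed_algebra_hull)
  let ?S = "recognised \<X> A \<union> meeting_langs \<X> A"
  show S: "?S \<subseteq> Pow (words A)"
    by (intro Un_least recognised_subset_Pow meeting_langs_subset_Pow)
  interpret H: algebra "words A" "algebra (words A) hull ?S"
    using S by (rule algebra_hull)
  have sub: "M \<in> algebra (words A) hull ?S" if "M \<in> ?S" for M
    using that hull_subset[of ?S] by blast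
  fix L u assume Lu: "L \<in> ?S" "u \<in> words A"
  show "{v \<in> words A. u @ v \<in> L} \<in> algebra (words A) hull ?S \<and>
      {v \<in> words A. v @ u \<in> L} \<in> algebra (words A) hull ?S"
  proof (cases "L \<in> recognised \<X> A")
    case True
    then show ?thesis
      using recognised_quotient[OF True Lu(2)] sub by blast
  next
    case False
    then have "L \<in> meeting_langs \<X> A"
      using Lu by blast
    note q = meeting_langs_quotient[OF this Lu(2)]
    show ?thesis
    proof
      obtain M N where "M \<in> recognised \<X> A" "N \<in> meeting_langs \<X> A" "{v \<in> words A. u @ v \<in> L} = M \<union> N"
        using q(1) by blast
      then show "{v \<in> words A. u @ v \<in> L} \<in> algebra (words A) hull ?S"
        using sub[of M] sub[of N] H.Un[of M N] by simp
      obtain M N where "M \<in> recognised \<X> A" "N \<in> meeting_langs \<X> A" "{v \<in> words A. v @ u \<in> L} = M \<union> N"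
        using q(2) by blast
      then show "{v \<in> words A. v @ u \<in> L} \<in> algebra (words A) hull ?S"
        using sub[of M] sub[of N] H.Un[of M N] by simp
    qed
  qed
qed

section \<open>Quantified languages as meeting languages\<close>

lemma exists_lang_in_meeting_langs:
  assumes "L \<in> recognised \<X> (A \<times> {0, 1})"
  shows "exists_lang A L \<in> meeting_langs \<X> A"
proof -
  obtain g V where L: "L = {w \<in> words (A \<times> {0, 1}). g w \<in> V}" and g: "word_hom (A \<times> {0, 1}) \<X> g"
    and V: "clopenin (space_of \<X>) V"
    using assms by (rule recognised_homE)
  define F where "F w = (\<lambda>i. g (gamma1 (w, i))) ` {..<length w}" for w :: "'a list"
  have "word_hom A (schutzenberger \<X>) (\<lambda>w. (F w, g (unmarked w)))"
    unfolding word_hom_schutzenberger_iff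
  proof (intro conjI ballI)
    show "word_hom A \<X> (\<lambda>w. g (unmarked w))"
      using g by (simp add: word_hom_def unmarked_in_words)
  next
    fix w assume w: "w \<in> words A"
    show "finite (F w)" by (simp add: F_def)
    show "F w \<noteq> {}" using w by (auto simp: F_def words_def)
    show "F w \<subseteq> sgp \<X>"
      using word_hom_mem[OF g gamma1_in_words[OF w]] by (auto simp: F_def)
  next
    fix u v assume uv: "u \<in> words A" "v \<in> words A"
    have left: "g (gamma1 (u @ v, i)) = mult \<X> (g (gamma1 (u, i))) (g (unmarked v))" if "i < length u" for i
      using that uv by (simp add: gamma1_append word_hom_append[OF g] gamma1_in_words unmarked_in_words)
    have right: "g (gamma1 (u @ v, length u + i)) = mult \<X> (g (unmarked u)) (g (gamma1 (v, i)))" for i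
      using uv by (simp add: gamma1_append word_hom_append[OF g] gamma1_in_words unmarked_in_words)
    \<comment> \<open>Positions of the mark are split at the border of \<open>u\<close> and
      \<open>v\<close>; those in \<open>v\<close> are shifted by \<open>length u\<close>.\<close>
    have "{..<length (u @ v)} = {..<length u} \<union> (+) (length u) ` {..<length v}"
      by (auto simp: lessThan_atLeast0)
    then have "F (u @ v) = (\<lambda>i. g (gamma1 (u @ v, i))) ` {..<length u} \<union>
        (\<lambda>i. g (gamma1 (u @ v, length u + i))) ` {..<length v}"
      by (simp only: F_def image_Un image_image)
    also have "\<dots> = (\<lambda>p. mult \<X> p (g (unmarked v))) ` F u \<union> mult \<X> (g (unmarked u)) ` F v"
      by (simp add: F_def image_image left right)
    finally show "F (u @ v) = (\<lambda>p. mult \<X> p (g (unmarked v))) ` F u \<union> mult \<X> (g (unmarked u)) ` F v" .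
  qed
  moreover have "exists_lang A L = {w \<in> words A. F w \<inter> V \<noteq> {}}"
    unfolding L exists_lang_preimage by (auto simp: F_def)
  ultimately show ?thesis
    using meeting_langsI[OF _ V] by simp
qed

text \<open>The hull on the right is an algebra closed under quotients and contains every generator,
  while \<open>recognised_exists\<close> is the least such family.\<close>

lemma recognised_exists_subset_hull:
  "recognised_exists \<X> A \<subseteq> algebra (words A) hull (recognised \<X> A \<union> meeting_langs \<X> A)"
  unfolding recognised_exists_def
proof (rule hull_minimal)
  show "{exists_lang A L |L. L \<in> recognised \<X> (A \<times> {0, 1})}
      \<subseteq> algebra (words A) hull (recognised \<X> A \<union> meeting_langs \<X> A)"
    using exists_lang_in_meeting_langs hull_subset[of "recognised \<X> A \<union> meeting_langs \<X> A"] by blast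
  have "algebra (words A) (algebra (words A) hull (recognised \<X> A \<union> meeting_langs \<X> A))"
    by (intro algebra_hull Un_least recognised_subset_Pow meeting_langs_subset_Pow)
  then show "algebra (words A) (algebra (words A) hull (recognised \<X> A \<union> meeting_langs \<X> A)) \<and>
      quotient_closed A (algebra (words A) hull (recognised \<X> A \<union> meeting_langs \<X> A))"
    using quotient_closed_meeting_hull by simp
qed

text \<open>Makes \<open>algebra_hull\<close> applicable to generating sets that include
  \<open>recognised_exists\<close>.\<close>

lemma recognised_exists_subset_Pow: "recognised_exists \<X> A \<subseteq> Pow (words A)"
proof -
  have "algebra (words A) hull (recognised \<X> A \<union> meeting_langs \<X> A) \<subseteq> Pow (words A)"
    by (intro hull_minimal Un_least recognised_subset_Pow meeting_langs_subset_Pow algebra_Pow)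
  then show ?thesis
    using recognised_exists_subset_hull by blast
qed

section \<open>Meeting languages as finite unions of quantified languages\<close>

lemma word_hom_letter_hom:
  assumes c: "\<And>a. a \<in> A \<Longrightarrow> c a \<in> sgp \<X>"
  shows "word_hom A \<X> (letter_hom (mult \<X>) c)"
proof -
  have mem: "letter_hom (mult \<X>) c w \<in> sgp \<X>" if "w \<in> words A" for w
    using that
  proof (induction rule: words_induct)
    case (Cons a w)
    then have "w \<noteq> []" by (simp add: words_def)
    then show ?case using Cons c by (simp add: letter_hom_Cons mult_closed)
  qed (simp add: c)
  have "letter_hom (mult \<X>) c (u @ v) = mult \<X> (letter_hom (mult \<X>) c u) (letter_hom (mult \<X>) c v)"
    if "u \<in> words A" "v \<in> words A" for u v
    using that
  proof (induction rule: words_induct)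
    case (single a)
    then have "v \<noteq> []" by (simp add: words_def)
    then show ?case by (simp add: letter_hom_Cons)
  next
    case (Cons a w)
    then have "w \<noteq> []" by (simp add: words_def)
    then show ?case using Cons c mem by (simp add: letter_hom_Cons mult_assoc)
  qed
  then show ?thesis
    using mem by (simp add: word_hom_def)
qed

text \<open>Expanding the product \<open>(F w, g w)\<close> of the letters of \<open>w\<close>, an element of \<open>F w\<close> arises by
  replacing one letter \<open>a\<close> by an element of \<open>F [a]\<close> and all the others by their values under \<open>g\<close>.
  It therefore suffices to consider the finitely many choice functions \<open>c\<close>.\<close>

lemma meeting_langs_subset_hull_exists:
  assumes fin: "finite A"
  shows "meeting_langs \<X> A \<subseteq> algebra (words A) hull (recognised \<X> A \<union> recognised_exists \<X> A)"
    (is "_ \<subseteq> ?H")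
proof
  interpret H: algebra "words A" ?H
    by (intro algebra_hull Un_least recognised_subset_Pow recognised_exists_subset_Pow)
  fix L assume "L \<in> meeting_langs \<X> A"
  then obtain F g V where L: "L = {w \<in> words A. F w \<inter> V \<noteq> {}}"
    and h: "word_hom A (schutzenberger \<X>) (\<lambda>w. (F w, g w))" and V: "clopenin (space_of \<X>) V"
    unfolding meeting_langs_def by blast
  have g: "word_hom A \<X> g" and F: "\<And>w. w \<in> words A \<Longrightarrow> finite (F w) \<and> F w \<noteq> {} \<and> F w \<subseteq> sgp \<X>"
    and app: "\<And>u v. u \<in> words A \<Longrightarrow> v \<in> words A \<Longrightarrow>
      F (u @ v) = (\<lambda>p. mult \<X> p (g v)) ` F u \<union> mult \<X> (g u) ` F v"
    using h unfolding word_hom_schutzenberger_iff by auto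
  have letter: "[a] \<in> words A" if "a \<in> A" for a
    using that by (simp add: words_def)
  \<comment> \<open>\<open>PiE\<close> fixes the values outside \<open>A\<close>, so that finiteness
    of \<open>A\<close> and of each \<open>F [a]\<close> makes \<open>\<C>\<close> finite.\<close>
  define \<C> where "\<C> = PiE A (\<lambda>a. F [a])"
  \<comment> \<open>An unmarked letter keeps its value under \<open>g\<close>; a marked one takes
    the value chosen by \<open>c\<close>.\<close>
  define G where "G c = letter_hom (mult \<X>) (\<lambda>(a, n). if n = (0::nat) then g [a] else c a)" for c
  have "finite \<C>"
    unfolding \<C>_def using fin F letter by (blast intro: finite_PiE)
  have G: "word_hom (A \<times> {0, 1}) \<X> (G c)" if "c \<in> \<C>" for c
    unfolding G_def
  proof (rule word_hom_letter_hom)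
    fix a assume "a \<in> A \<times> {0::nat, 1}"
    then show "(case a of (a, n) \<Rightarrow> if n = 0 then g [a] else c a) \<in> sgp \<X>"
      using that F letter word_hom_mem[OF g] by (auto simp: \<C>_def dest!: PiE_mem) blast+
  qed
  have unmarked: "G c (unmarked w) = g w" if "w \<in> words A" for c w
    using that
  proof (induction rule: words_induct)
    case (Cons a w)
    then have "unmarked w \<noteq> []" by (simp add: words_def)
    then show ?case
      using Cons word_hom_append[OF g letter, of a w] by (simp add: G_def letter_hom_Cons)
  qed (simp add: G_def)
  have letters: "x \<in> F [a] \<longleftrightarrow> (\<exists>c\<in>\<C>. x = c a)" if a: "a \<in> A" for a x
  proof
    assume x: "x \<in> F [a]"
    \<comment> \<open>A choice function through the given \<open>x\<close> at \<open>a\<close>; at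
      the other letters any element will do, since each \<open>F [b]\<close> is nonempty.\<close>
    define c where "c = (\<lambda>b\<in>A. if b = a then x else SOME y. y \<in> F [b])"
    have "(SOME y. y \<in> F [b]) \<in> F [b]" if "b \<in> A" for b
      using F[OF letter[OF that]] by (simp add: some_in_eq)
    then have "c \<in> \<C>"
      unfolding \<C>_def c_def using x by (intro PiE_I) auto
    moreover have "x = c a"
      using a by (simp add: c_def)
    ultimately show "\<exists>c\<in>\<C>. x = c a"
      by blast
  qed (use a in \<open>auto simp: \<C>_def dest: PiE_mem\<close>)
  \<comment> \<open>Induction on the first letter: a mark on it yields an element of
    \<open>F [a]\<close> times \<open>g w\<close>, a mark further on yields \<open>g [a]\<close>
    times an element of \<open>F w\<close>. Only one letter is marked, so \<open>c\<close> is
    consulted once.\<close>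
  have expand: "x \<in> F w \<longleftrightarrow> (\<exists>c\<in>\<C>. \<exists>i<length w. x = G c (gamma1 (w, i)))" if "w \<in> words A" for w x
    using that
  proof (induction arbitrary: x rule: words_induct)
    case (single a)
    then show ?case
      by (simp add: gamma1_def G_def letters)
  next
    case (Cons a w)
    have ne: "w \<noteq> []" "unmarked w \<noteq> []" "gamma1 (w, i) \<noteq> []" for i
      using Cons by (auto simp: words_def gamma1_def)
    have "gamma1 ([a] @ w, 0) = (a, 1) # unmarked w"
      unfolding gamma1_append by (simp add: gamma1_def)
    then have G0: "G c (gamma1 (a # w, 0)) = mult \<X> (c a) (g w)" for c
      using ne(2) unmarked[OF Cons(2)] by (simp add: G_def letter_hom_Cons)
    have "gamma1 ([a] @ w, Suc i) = (a, 0) # gamma1 (w, i)" for i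
      unfolding gamma1_append by simp
    then have GS: "G c (gamma1 (a # w, Suc i)) = mult \<X> (g [a]) (G c (gamma1 (w, i)))" for c i
      using ne(3) by (simp add: G_def letter_hom_Cons)
    have "x \<in> F (a # w) \<longleftrightarrow> (\<exists>p\<in>F [a]. x = mult \<X> p (g w)) \<or> (\<exists>q\<in>F w. x = mult \<X> (g [a]) q)"
      using app[OF letter Cons(2), of a] Cons(1) by auto
    also have "\<dots> \<longleftrightarrow> (\<exists>c\<in>\<C>. x = mult \<X> (c a) (g w)) \<or>
        (\<exists>c\<in>\<C>. \<exists>i<length w. x = mult \<X> (g [a]) (G c (gamma1 (w, i))))"
    proof -
      have "(\<exists>p\<in>F [a]. x = mult \<X> p (g w)) \<longleftrightarrow> (\<exists>c\<in>\<C>. x = mult \<X> (c a) (g w))"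
      proof -
        have "F [a] = (\<lambda>c. c a) ` \<C>"
          using letters[OF Cons(1)] by (intro set_eqI) (simp add: image_iff)
        then show ?thesis by simp
      qed
      moreover have "(\<exists>q\<in>F w. x = mult \<X> (g [a]) q) \<longleftrightarrow>
          (\<exists>c\<in>\<C>. \<exists>i<length w. x = mult \<X> (g [a]) (G c (gamma1 (w, i))))"
        unfolding Bex_def Cons.IH by metis
      ultimately show ?thesis by simp
    qed
    \<comment> \<open>\<open>Ex_less_Suc2\<close> separates position \<open>0\<close>, the first
      letter, from the positions \<open>Suc i\<close> inside \<open>w\<close>.\<close>
    also have "\<dots> \<longleftrightarrow> (\<exists>c\<in>\<C>. \<exists>i<length (a # w). x = G c (gamma1 (a # w, i)))"
      unfolding list.size Ex_less_Suc2 add_0_right add_Suc_right G0 GS by blast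
    finally show ?case .
  qed
  let ?S = "recognised \<X> A \<union> recognised_exists \<X> A"
  have meets: "F w \<inter> V \<noteq> {} \<longleftrightarrow> (\<exists>c\<in>\<C>. \<exists>i<length w. G c (gamma1 (w, i)) \<in> V)"
    if "w \<in> words A" for w
  proof -
    have "F w \<inter> V \<noteq> {} \<longleftrightarrow> (\<exists>x. x \<in> F w \<and> x \<in> V)"
      by blast
    then show ?thesis
      unfolding expand[OF that] by blast
  qed
  \<comment> \<open>The two existential quantifiers are exchanged: over \<open>c\<close> it becomes
    a finite union, over the position it becomes \<open>exists_lang\<close>.\<close>
  have "L = (\<Union>c\<in>\<C>. exists_lang A {w \<in> words (A \<times> {0, 1}). G c w \<in> V})"
    unfolding L exists_lang_preimage using meets by auto
  moreover have "exists_lang A {w \<in> words (A \<times> {0, 1}). G c w \<in> V} \<in> ?H" if "c \<in> \<C>" for c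
  proof -
    have "exists_lang A {w \<in> words (A \<times> {0, 1}). G c w \<in> V} \<in> recognised_exists \<X> A"
      unfolding recognised_exists_def
      by (rule subsetD[OF hull_subset]) (use recognised_homI[OF G[OF that] V] in blast)
    then show ?thesis
      using hull_subset[of ?S] by blast
  qed
  ultimately show "L \<in> ?H"
    using \<open>finite \<C>\<close> by (simp add: H.finite_UN)
qed

end

theorem theorem4p11:
  fixes \<Sigma> :: "'a set" and \<X> :: "'x internal_sgp"
  assumes "finite \<Sigma>"
    and "Boolean_space_internal_semigroup \<X>"
  shows "algebra (words \<Sigma>) hull recognised (schutzenberger \<X>) \<Sigma> =
         algebra (words \<Sigma>) hull (recognised \<X> \<Sigma> \<union> recognised_exists \<X> \<Sigma>)"
proof -
  interpret Boolean_space_internal_semigroup \<X> by fact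
  let ?G = "recognised \<X> \<Sigma> \<union> meeting_langs \<X> \<Sigma>" and ?E = "recognised \<X> \<Sigma> \<union> recognised_exists \<X> \<Sigma>"
  \<comment> \<open>By \<open>algebra_hull_recognised_schutzenberger\<close> the hull of
    \<open>?G\<close> is the left-hand side of the goal, so it remains to compare the hulls of
    \<open>?G\<close> and \<open>?E\<close>.\<close>
  have "algebra (words \<Sigma>) hull ?G \<subseteq> algebra (words \<Sigma>) hull ?E"
  proof (rule hull_minimal)
    show "?G \<subseteq> algebra (words \<Sigma>) hull ?E"
      using meeting_langs_subset_hull_exists[OF assms(1)] hull_subset[of ?E] by blast
    show "algebra (words \<Sigma>) (algebra (words \<Sigma>) hull ?E)"
      by (intro algebra_hull Un_least recognised_subset_Pow recognised_exists_subset_Pow)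
  qed
  moreover have "algebra (words \<Sigma>) hull ?E \<subseteq> algebra (words \<Sigma>) hull ?G"
  proof (rule hull_minimal)
    show "?E \<subseteq> algebra (words \<Sigma>) hull ?G"
      using recognised_exists_subset_hull hull_subset[of ?G] by blast
    show "algebra (words \<Sigma>) (algebra (words \<Sigma>) hull ?G)"
      by (intro algebra_hull Un_least recognised_subset_Pow meeting_langs_subset_Pow)
  qed
  ultimately show ?thesis
    unfolding algebra_hull_recognised_schutzenberger by (rule antisym)
qed

end
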